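(* Let $\Lambda\subseteq\mathbb{R}^d$ be a $d$-dimensional lattice, $F\colon K\to\mathbb{R}$ a $\Lambda$-periodic filter on a $\Lambda$-periodic cell complex $K$, and $\Lambda',\Lambda''\subseteq\Lambda$ two $d$-dimensional sublattices. Then the periodic merge trees $\mathcal{M}(F,\Lambda')$ and $\mathcal{M}(F,\Lambda'')$ are equivalent, and hence the interleaving pseudo-distance between their equivalence classes vanishes: $J([\mathcal{M}(F,\Lambda')],[\mathcal{M}(F,\Lambda'')])=0$.
   Context: A cell complex $K$ in $\mathbb{R}^d$ is a locally finite collection of cells (each homeomorphic to a closed ball, boundaries unions of lower-dimensional cells, intersections unions of shared faces); $0$-cells are vertices, $1$-cells edges. A lattice spanned by linearly independent $u_1,\dots,u_p\in\mathbb{R}^d$ is the set of their integer combinations, of dimension $p$; $\mathrm{vol}_p$ denotes the $p$-dimensional volume of its unit cell $\{\sum c_iu_i : c_i\in[0,1)\}$ ($\mathrm{vol}_0(\{0\})=1$). $K$ is $\Lambda$-periodic if $\sigma+u\in K$ for $\sigma\in K,u\in\Lambda$; a filter $F\colon K\to\mathbb{R}$ satisfies $F(\sigma)\le F(\tau)$ when $\sigma$ is a face of $\tau$, and is $\Lambda$-periodic if $F(\sigma+u)=F(\sigma)$. For a sublattice $\Lambda'$ of full dimension, $F$ is also $\Lambda'$-periodic; $K/\Lambda'$ is the finite quotient complex on the torus $\mathbb{R}^d/\Lambda'$ and $F/\Lambda'$ the quotient filter. The merge tree of a filter $G$ on a complex $L$ is the quotient of $\{(x,s): x\in L_s\}$,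 $L_s=G^{-1}(-\infty,s]$, by $(x,s)\sim(y,t)$ iff $s=t$ and $x,y$ lie in the same component of $L_s$, with quotient topology and height $h$ (the $s$-coordinate); points are identified with components of sublevel sets; $B$ covers $A$ if $h(A)\le h(B)$ and $A\subseteq B$. For a component $\Gamma$ of $(K/\Lambda')_t$, with $\phi\colon\mathbb{R}^d\to\mathbb{R}^d/\Lambda'$ the projection, a shadow is a component of $\phi^{-1}(\Gamma)$ and the periodicity lattice is $\Lambda'_\Gamma=\{u\in\Lambda':\gamma+u=\gamma\}$ for a shadow $\gamma$; with $p=\dim\Lambda'_\Gamma$ and $\nu_q$ the volume of the unit $q$-ball, the shadow monomial is $\frac{\mathrm{vol}_p(\Lambda'_\Gamma)}{\mathrm{vol}_d(\Lambda')}\nu_{d-p}R^{d-p}$. The periodic merge tree $\mathcal{M}(F,\Lambda')$ is the merge tree of $F/\Lambda'$ with height $h$ and frequency function $\Phi$ assigning each point its shadow monomial. Monomials are ordered by $tR^a<sR^b$ iff $a<b$, or $a=b$ and $t<s$. Interleaving distance: for periodic merge trees $\mathcal{M},\mathcal{M}'$ with heights $h,h'$ and frequencies $\Phi,\Phi'$, continuous maps $\varphi\colon\mathcal{M}\to\mathcal{M}'$, $\psi\colon\mathcal{M}'\to\mathcal{M}$ are $\varepsilon$-compatible ($\varepsilon\ge0$) if for all $\Gamma\in\mathcal{M}$, $\Gamma'\in\mathcal{M}'$: (i) $h'(\varphi(\Gamma))=h(\Gamma)+\varepsilon$ and $h(\psi(\Gamma'))=h'(\Gamma')+\varepsilon$;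 (ii) $\psi(\varphi(\Gamma))$ covers $\Gamma$ and $\varphi(\psi(\Gamma'))$ covers $\Gamma'$; (iii) $\Phi'(\varphi(\Gamma))\le\Phi(\Gamma)$ and $\Phi(\psi(\Gamma'))\le\Phi'(\Gamma')$. $d_I(\mathcal{M},\mathcal{M}')$ is the infimum of such $\varepsilon$. Splintering: for $\Gamma\in\mathcal{M}$, $\mathcal{M}_\Gamma$ is the subtree of points covered by $\Gamma$. $\mathcal{M}'$ splinters $\mathcal{M}$ if there is a continuous surjection $\omega\colon\mathcal{M}'\to\mathcal{M}$ with $h\circ\omega=h'$ such that for every $\Gamma\in\mathcal{M}$ and all $A,B\in\omega^{-1}(\Gamma)$: $d_I(\mathcal{M}'_A,\mathcal{M}'_B)=0$, $\omega$ maps each of $\mathcal{M}'_A$ and $\mathcal{M}'_B$ surjectively onto $\mathcal{M}_\Gamma$, and $\Phi'(A)=\Phi'(B)=\Phi(\Gamma)/|\omega^{-1}(\Gamma)|$. Two periodic merge trees are equivalent, $\mathcal{M}\simeq\mathcal{N}$, if some periodic merge tree splinters both; $[\mathcal{M}]$ is the equivalence class. The interleaving pseudo-distance is $J([\mathcal{M}],[\mathcal{M}'])=\inf\sum_{i=1}^k d_I(\mathcal{M}_i,\mathcal{M}_i')$ over all finite sequences with $\mathcal{M}_1\in[\mathcal{M}]$, $\mathcal{M}_k'\in[\mathcal{M}']$ and $\mathcal{M}_i'\simeq\mathcal{M}_{i+1}$ for $1\le i\le k-1$. *)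

theory Defs
  imports "HOL-Analysis.Analysis"
begin

definition lattice_of :: "'a::euclidean_space list \<Rightarrow> 'a set" where
  "lattice_of b = {(\<Sum>i<length b. of_int (c i) *\<^sub>R (b ! i)) | c. True}"

definition lattice_basis_of :: "'a::euclidean_space set \<Rightarrow> 'a list \<Rightarrow> bool" where
  "lattice_basis_of L b \<longleftrightarrow> distinct b \<and> independent (set b) \<and> L = lattice_of b"

definition is_lattice :: "'a::euclidean_space set \<Rightarrow> nat \<Rightarrow> bool" where
  "is_lattice L p \<longleftrightarrow> (\<exists>b. lattice_basis_of L b \<and> length b = p)"

definition lattice_basis :: "'a::euclidean_space set \<Rightarrow> 'a list" where
  "lattice_basis L = (SOME b. lattice_basis_of L b)"

definition lattice_dim :: "'a::euclidean_space set \<Rightarrow> nat" where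
  "lattice_dim L = length (lattice_basis L)"

text \<open>Gram determinant (Leibniz formula); its square root is the p-dimensional
  volume of the unit cell spanned by the list.\<close>
definition gram_det :: "'a::euclidean_space list \<Rightarrow> real" where
  "gram_det b = (\<Sum>\<pi> | \<pi> permutes {..<length b}.
      of_int (sign \<pi>) * (\<Prod>i<length b. (b ! i) \<bullet> (b ! (\<pi> i))))"

definition lattice_vol :: "'a::euclidean_space set \<Rightarrow> real" where
  "lattice_vol L = sqrt (gram_det (lattice_basis L))"

definition cell_of_dim :: "'a::euclidean_space set \<Rightarrow> nat \<Rightarrow> bool" where
  "cell_of_dim \<sigma> k \<longleftrightarrow> (\<exists>S::'a set. subspace S \<and> dim S = k \<and> (cball 0 1 \<inter> S) homeomorphic \<sigma>)"

definition face_of_cell :: "'a set set \<Rightarrow> 'a set \<Rightarrow> 'a set \<Rightarrow> bool" where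
  "face_of_cell K \<tau> \<sigma> \<longleftrightarrow> \<tau> \<in> K \<and> \<sigma> \<in> K \<and> \<tau> \<subseteq> \<sigma>"

definition cell_complex :: "'a::euclidean_space set set \<Rightarrow> bool" where
  "cell_complex K \<longleftrightarrow>
     (\<forall>x::'a. \<exists>e>0. finite {\<sigma>\<in>K. \<sigma> \<inter> ball x e \<noteq> {}}) \<and>
     (\<forall>\<sigma>\<in>K. \<exists>(S::'a set) f g. subspace S \<and>
        homeomorphism (cball 0 1 \<inter> S) \<sigma> f g \<and>
        f ` (sphere 0 1 \<inter> S) =
          \<Union>{\<tau>\<in>K. \<tau> \<subseteq> \<sigma> \<and> (\<exists>k<dim S. cell_of_dim \<tau> k)}) \<and>
     (\<forall>\<sigma>\<in>K. \<forall>\<tau>\<in>K. \<sigma> \<inter> \<tau> = \<Union>{\<rho>. face_of_cell K \<rho> \<sigma> \<and> face_of_cell K \<rho> \<tau>})"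

definition periodic_complex :: "'a::euclidean_space set set \<Rightarrow> 'a set \<Rightarrow> bool" where
  "periodic_complex K L \<longleftrightarrow> (\<forall>\<sigma>\<in>K. \<forall>u\<in>L. (\<lambda>x. x + u) ` \<sigma> \<in> K)"

definition filter_mono :: "'a set set \<Rightarrow> ('a set \<Rightarrow> real) \<Rightarrow> bool" where
  "filter_mono K F \<longleftrightarrow> (\<forall>\<sigma> \<tau>. face_of_cell K \<sigma> \<tau> \<longrightarrow> F \<sigma> \<le> F \<tau>)"

definition periodic_filter :: "'a::euclidean_space set set \<Rightarrow> ('a set \<Rightarrow> real) \<Rightarrow> 'a set \<Rightarrow> bool" where
  "periodic_filter K F L \<longleftrightarrow> (\<forall>\<sigma>\<in>K. \<forall>u\<in>L. F ((\<lambda>x. x + u) ` \<sigma>) = F \<sigma>)"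

definition quotient_topology :: "'a topology \<Rightarrow> ('a \<Rightarrow> 'b) \<Rightarrow> 'b topology" where
  "quotient_topology X f =
     topology (\<lambda>U. U \<subseteq> f ` topspace X \<and> openin X {x \<in> topspace X. f x \<in> U})"

definition tproj :: "'a::euclidean_space set \<Rightarrow> 'a \<Rightarrow> 'a set" where
  "tproj L x = (\<lambda>u. x + u) ` L"

definition torus :: "'a::euclidean_space set \<Rightarrow> 'a set topology" where
  "torus L = quotient_topology euclidean (tproj L)"

text \<open>Sublevel set K_s (in R^d) and its image (K/L)_s on the torus (the sublevel
  set of the quotient filter F/L).\<close>
definition sublevel :: "'a set set \<Rightarrow> ('a set \<Rightarrow> real) \<Rightarrow> real \<Rightarrow> 'a set" where
  "sublevel K F s = \<Union>{\<sigma>\<in>K. F \<sigma> \<le> s}"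

definition qsublevel :: "'a::euclidean_space set set \<Rightarrow> ('a set \<Rightarrow> real) \<Rightarrow> 'a set \<Rightarrow> real \<Rightarrow> 'a set set" where
  "qsublevel K F L s = tproj L ` sublevel K F s"

text \<open>Periodic merge tree data: topological space of points, height, frequency.
  A monomial t R^a is represented by the pair (t, a).\<close>
record 'p pmt =
  ptop :: "'p topology"
  pht :: "'p \<Rightarrow> real"
  pfreq :: "'p \<Rightarrow> real \<times> nat"

text \<open>Points of a merge tree are components of sublevel sets together with their height.\<close>
type_synonym 'a mtpoint = "'a set set \<times> real"

definition mt_class :: "'a::euclidean_space set set \<Rightarrow> ('a set \<Rightarrow> real) \<Rightarrow> 'a set \<Rightarrow> 'a set \<times> real \<Rightarrow> 'a mtpoint" where
  "mt_class K F L = (\<lambda>(p, s). (connected_component_of_set (subtopology (torus L) (qsublevel K F L s)) p, s))"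

definition mt_top :: "'a::euclidean_space set set \<Rightarrow> ('a set \<Rightarrow> real) \<Rightarrow> 'a set \<Rightarrow> 'a mtpoint topology" where
  "mt_top K F L = quotient_topology
     (subtopology (prod_topology (torus L) euclideanreal) {(p, s). p \<in> qsublevel K F L s})
     (mt_class K F L)"

definition shadow :: "'a::euclidean_space set \<Rightarrow> 'a set set \<Rightarrow> 'a set" where
  "shadow L \<Gamma> = (SOME \<gamma>. \<gamma> \<in> components {x. tproj L x \<in> \<Gamma>})"

definition period_lattice :: "'a::euclidean_space set \<Rightarrow> 'a set set \<Rightarrow> 'a set" where
  "period_lattice L \<Gamma> = {u\<in>L. (\<lambda>x. x + u) ` shadow L \<Gamma> = shadow L \<Gamma>}"

definition shadow_monomial :: "'a::euclidean_space set \<Rightarrow> 'a set set \<Rightarrow> real \<times> nat" where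
  "shadow_monomial L \<Gamma> =
     (let P = period_lattice L \<Gamma>; p = lattice_dim P
      in (lattice_vol P / lattice_vol L * unit_ball_vol (real (DIM('a) - p)), DIM('a) - p))"

definition merge_tree :: "'a::euclidean_space set set \<Rightarrow> ('a set \<Rightarrow> real) \<Rightarrow> 'a set \<Rightarrow> 'a mtpoint pmt" where
  "merge_tree K F L = \<lparr> ptop = mt_top K F L, pht = snd, pfreq = (\<lambda>\<Gamma>. shadow_monomial L (fst \<Gamma>)) \<rparr>"

definition is_pmt :: "'a::euclidean_space mtpoint pmt \<Rightarrow> bool" where
  "is_pmt M \<longleftrightarrow> (\<exists>K F L. is_lattice L DIM('a) \<and> cell_complex K \<and> periodic_complex K L \<and>
      filter_mono K F \<and> periodic_filter K F L \<and> M = merge_tree K F L)"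

definition mono_le :: "real \<times> nat \<Rightarrow> real \<times> nat \<Rightarrow> bool" where
  "mono_le m m' \<longleftrightarrow> snd m < snd m' \<or> (snd m = snd m' \<and> fst m \<le> fst m')"

text \<open>covers A B: B covers A.\<close>
definition covers :: "'t set \<times> real \<Rightarrow> 't set \<times> real \<Rightarrow> bool" where
  "covers A B \<longleftrightarrow> snd A \<le> snd B \<and> fst A \<subseteq> fst B"

definition compatible :: "real \<Rightarrow> ('t set \<times> real) pmt \<Rightarrow> ('t set \<times> real) pmt \<Rightarrow>
    ('t set \<times> real \<Rightarrow> 't set \<times> real) \<Rightarrow> ('t set \<times> real \<Rightarrow> 't set \<times> real) \<Rightarrow> bool" where
  "compatible \<epsilon> M M' \<phi> \<psi> \<longleftrightarrow> \<epsilon> \<ge> 0 \<and>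
     continuous_map (ptop M) (ptop M') \<phi> \<and> continuous_map (ptop M') (ptop M) \<psi> \<and>
     (\<forall>\<Gamma>\<in>topspace (ptop M). pht M' (\<phi> \<Gamma>) = pht M \<Gamma> + \<epsilon> \<and> covers \<Gamma> (\<psi> (\<phi> \<Gamma>)) \<and>
        mono_le (pfreq M' (\<phi> \<Gamma>)) (pfreq M \<Gamma>)) \<and>
     (\<forall>\<Gamma>'\<in>topspace (ptop M'). pht M (\<psi> \<Gamma>') = pht M' \<Gamma>' + \<epsilon> \<and> covers \<Gamma>' (\<phi> (\<psi> \<Gamma>')) \<and>
        mono_le (pfreq M (\<psi> \<Gamma>')) (pfreq M' \<Gamma>'))"

definition dI :: "('t set \<times> real) pmt \<Rightarrow> ('t set \<times> real) pmt \<Rightarrow> ereal" where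
  "dI M M' = Inf {ereal \<epsilon> | \<epsilon>. \<exists>\<phi> \<psi>. compatible \<epsilon> M M' \<phi> \<psi>}"

definition subtree :: "('t set \<times> real) pmt \<Rightarrow> 't set \<times> real \<Rightarrow> ('t set \<times> real) pmt" where
  "subtree M \<Gamma> = \<lparr> ptop = subtopology (ptop M) {A \<in> topspace (ptop M). covers A \<Gamma>},
                    pht = pht M, pfreq = pfreq M \<rparr>"

definition splinters :: "('t set \<times> real) pmt \<Rightarrow> ('t set \<times> real) pmt \<Rightarrow> bool" where
  "splinters N M \<longleftrightarrow> (\<exists>\<omega>. continuous_map (ptop N) (ptop M) \<omega> \<and>
     \<omega> ` topspace (ptop N) = topspace (ptop M) \<and>
     (\<forall>x\<in>topspace (ptop N). pht M (\<omega> x) = pht N x) \<and>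
     (\<forall>\<Gamma>\<in>topspace (ptop M). \<forall>A B. A \<in> topspace (ptop N) \<and> \<omega> A = \<Gamma> \<and>
          B \<in> topspace (ptop N) \<and> \<omega> B = \<Gamma> \<longrightarrow>
        dI (subtree N A) (subtree N B) = 0 \<and>
        \<omega> ` topspace (ptop (subtree N A)) = topspace (ptop (subtree M \<Gamma>)) \<and>
        \<omega> ` topspace (ptop (subtree N B)) = topspace (ptop (subtree M \<Gamma>)) \<and>
        (let n = card {x \<in> topspace (ptop N). \<omega> x = \<Gamma>};
             m = (fst (pfreq M \<Gamma>) / real n, snd (pfreq M \<Gamma>))
         in pfreq N A = m \<and> pfreq N B = m)))"

definition pmt_equiv :: "'a::euclidean_space mtpoint pmt \<Rightarrow> 'a mtpoint pmt \<Rightarrow> bool" where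
  "pmt_equiv M N \<longleftrightarrow> (\<exists>P. is_pmt P \<and> splinters P M \<and> splinters P N)"

definition J_dist :: "'a::euclidean_space mtpoint pmt \<Rightarrow> 'a mtpoint pmt \<Rightarrow> ereal" where
  "J_dist M M' = Inf {(\<Sum>i<k. dI (Ms i) (Ms' i)) | (k::nat) (Ms :: nat \<Rightarrow> 'a mtpoint pmt) (Ms' :: nat \<Rightarrow> 'a mtpoint pmt). k \<ge> 1 \<and>
      (\<forall>i<k. is_pmt (Ms i) \<and> is_pmt (Ms' i)) \<and>
      pmt_equiv (Ms 0) M \<and> pmt_equiv (Ms' (k - 1)) M' \<and>
      (\<forall>i. i + 1 < k \<longrightarrow> pmt_equiv (Ms' i) (Ms (i + 1)))}"

end

theory Submission
  imports Defs "Jordan_Normal_Form.Determinant"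
begin

text \<open>Both merge trees are splintered by the one of \<open>L0 = \<Lambda>' \<inter> \<Lambda>''\<close>. For \<open>L0 \<subseteq> L\<close>, the components of
  a sublevel set of \<open>K/L\<close> are the images of the components \<open>\<gamma>\<close> of the sublevel set of \<open>K\<close>, so the
  fibre over the image of \<open>\<gamma>\<close> consists of the images of its translates \<open>\<gamma> + u\<close> with \<open>u \<in> L\<close>. The
  translations are automorphisms of the tree of \<open>L0\<close> that permute the fibre, and the size of
  the fibre is \<open>[L : P + L0]\<close>, where \<open>P\<close> is the stabilizer of \<open>\<gamma>\<close> in \<open>L\<close>. The frequencies match
  because the volume of a sublattice grows with its index and
  \<open>[L : L0] = [L : P + L0] \<cdot> [P : P \<inter> L0]\<close>.\<close>

section \<open>Subgroups and their indices\<close>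

text \<open>The intersection \<open>L0\<close> still has full dimension because finite index
  survives intersection: \<open>\<Lambda>''\<close> has finite index in \<open>\<Lambda>\<close>, so
  \<open>\<Lambda>' \<inter> \<Lambda>''\<close> has finite index in \<open>\<Lambda>'\<close>, and
  a subgroup of finite index spans the same space. The same argument gives \<open>P\<close> and
  \<open>P \<inter> L0\<close> equal dimension, so the exponents of the monomials agree. The
  stabilizer \<open>P\<close> can have any rank from 0 to the full dimension, so volumes have to be
  compared below full rank too. Gram determinants do this: passing to a sublattice multiplies them
  by the squared determinant of an integral transition matrix, and a triangular basis identifies
  that determinant with the index. For \<open>k = [P : P \<inter> L0]\<close> and fibre size
  \<open>n\<close>, the coefficients satisfy vol(P \<inter> L0) / vol(L0) = k vol(P) / (n k vol(L)),
  and \<open>k\<close> cancels. On the topological side, a component on the torus could a priori be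
  larger than the image of a component upstairs; local finiteness of the complex rules this
  out.\<close>

definition add_subgroup :: "'a::ab_group_add set \<Rightarrow> bool" where
  "add_subgroup G \<longleftrightarrow> 0 \<in> G \<and> (\<forall>x\<in>G. \<forall>y\<in>G. x - y \<in> G)"

lemma add_subgroup_0: "add_subgroup G \<Longrightarrow> 0 \<in> G"
  and add_subgroup_diff: "add_subgroup G \<Longrightarrow> x \<in> G \<Longrightarrow> y \<in> G \<Longrightarrow> x - y \<in> G"
  by (auto simp: add_subgroup_def)

lemma add_subgroup_minus: "add_subgroup G \<Longrightarrow> x \<in> G \<Longrightarrow> - x \<in> G"
  using add_subgroup_diff[of G 0 x] by (simp add: add_subgroup_0)

lemma add_subgroup_add: "add_subgroup G \<Longrightarrow> x \<in> G \<Longrightarrow> y \<in> G \<Longrightarrow> x + y \<in> G"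
  using add_subgroup_diff[of G x "- y"] by (simp add: add_subgroup_minus)

lemma add_subgroup_Int: "add_subgroup G \<Longrightarrow> add_subgroup H \<Longrightarrow> add_subgroup (G \<inter> H)"
  by (simp add: add_subgroup_def)

definition set_sum :: "'a::ab_group_add set \<Rightarrow> 'a set \<Rightarrow> 'a set" where
  "set_sum G H = {x + y | x y. x \<in> G \<and> y \<in> H}"

lemma add_subgroup_set_sum:
  assumes "add_subgroup G" "add_subgroup H"
  shows "add_subgroup (set_sum G H)"
  unfolding add_subgroup_def
proof (intro conjI ballI)
  show "0 \<in> set_sum G H"
    using assms add_subgroup_0 unfolding set_sum_def by force
  fix x y assume "x \<in> set_sum G H" "y \<in> set_sum G H"
  then obtain a b a' b' where "a \<in> G" "b \<in> H" "a' \<in> G" "b' \<in> H" "x = a + b" "y = a' + b'"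
    unfolding set_sum_def by blast
  moreover from this have "x - y = (a - a') + (b - b')" by simp
  ultimately show "x - y \<in> set_sum G H"
    using assms add_subgroup_diff unfolding set_sum_def by blast
qed

lemma add_subgroup_scale_int:
  fixes x :: "'a::real_vector"
  assumes "add_subgroup G" "x \<in> G"
  shows "of_int n *\<^sub>R x \<in> G"
proof -
  have nat: "of_nat k *\<^sub>R x \<in> G" for k :: nat
    by (induction k) (auto simp: assms add_subgroup_0 add_subgroup_add scaleR_left_distrib)
  show ?thesis
  proof (cases "n \<ge> 0")
    case True
    then show ?thesis using nat[of "nat n"] by simp
  next
    case False
    then show ?thesis using add_subgroup_minus[OF assms(1) nat[of "nat (- n)"]] by simp
  qed
qed

lemma tproj_eq_iff:
  assumes "add_subgroup G"
  shows "tproj G x = tproj G y \<longleftrightarrow> x - y \<in> G"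
proof
  assume "tproj G x = tproj G y"
  then have "x \<in> tproj G y"
    unfolding tproj_def using add_subgroup_0[OF assms] by (metis add.right_neutral imageI)
  then show "x - y \<in> G" unfolding tproj_def by auto
next
  assume d: "x - y \<in> G"
  have "x + u \<in> (\<lambda>u. y + u) ` G" if "u \<in> G" for u
    using add_subgroup_add[OF assms d that] by (force simp: algebra_simps)
  moreover have "y + u \<in> (\<lambda>u. x + u) ` G" if "u \<in> G" for u
    using add_subgroup_diff[OF assms that d] by (force simp: algebra_simps)
  ultimately show "tproj G x = tproj G y" unfolding tproj_def by blast
qed

text \<open>The tower law through \<open>H + G\<close>, combined with the second isomorphism
  theorem. If \<open>R\<close> represents the cosets of \<open>H + G\<close> in \<open>M\<close> and
  \<open>T\<close> those of \<open>H \<inter> G\<close> in \<open>H\<close>, then the sums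
  \<open>r + t\<close> represent the cosets of \<open>G\<close> in \<open>M\<close>. A quotient
  \<open>M/G\<close> is written throughout as the image of \<open>M\<close> under
  \<open>tproj G\<close>, the map that also defines the torus.\<close>

lemma coset_product_bij:
  fixes M :: "'a::euclidean_space set"
  assumes M: "add_subgroup M" and G: "add_subgroup G" "G \<subseteq> M" and H: "add_subgroup H" "H \<subseteq> M"
  shows "\<exists>f. bij_betw f (tproj (set_sum H G) ` M \<times> tproj (H \<inter> G) ` H) (tproj G ` M)"
proof -
  let ?S = "set_sum H G"
  have S: "add_subgroup ?S" and I: "add_subgroup (H \<inter> G)"
    using add_subgroup_set_sum add_subgroup_Int G H by auto
  obtain R where R: "R \<subseteq> M" "inj_on (tproj ?S) R" "tproj ?S ` M = tproj ?S ` R"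
    using subset_image_inj[of "tproj ?S ` M" "tproj ?S" M] by auto
  obtain T where T: "T \<subseteq> H" "inj_on (tproj (H \<inter> G)) T" "tproj (H \<inter> G) ` H = tproj (H \<inter> G) ` T"
    using subset_image_inj[of "tproj (H \<inter> G) ` H" "tproj (H \<inter> G)" H] by auto
  let ?f = "\<lambda>(r, t). tproj G (r + t)"
  have inj: "inj_on ?f (R \<times> T)"
  proof (rule inj_onI, clarify)
    fix r t r' t' assume r: "r \<in> R" "r' \<in> R" and t: "t \<in> T" "t' \<in> T"
      and "tproj G (r + t) = tproj G (r' + t')"
    then have d: "(r + t) - (r' + t') \<in> G" by (simp add: tproj_eq_iff G)
    have "t' - t \<in> H" using t T(1) add_subgroup_diff[OF H(1)] by blast
    then have "(t' - t) + ((r + t) - (r' + t')) \<in> ?S"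
      using d unfolding set_sum_def by blast
    then have "r - r' \<in> ?S" by simp
    then have "tproj ?S r = tproj ?S r'" by (simp add: tproj_eq_iff[OF S])
    then have rr: "r = r'" using R(2) r by (simp add: inj_on_eq_iff)
    then have "t - t' \<in> G" using d by simp
    moreover have "t - t' \<in> H" using t T(1) add_subgroup_diff[OF H(1)] by blast
    ultimately have "tproj (H \<inter> G) t = tproj (H \<inter> G) t'" by (simp add: tproj_eq_iff[OF I])
    then have "t = t'" using T(2) t by (simp add: inj_on_eq_iff)
    with rr show "r = r' \<and> t = t'" by simp
  qed
  have "?f ` (R \<times> T) = tproj G ` M"
  proof
    show "?f ` (R \<times> T) \<subseteq> tproj G ` M"
      using R(1) T(1) H(2) by (auto intro!: imageI add_subgroup_add[OF M])
    show "tproj G ` M \<subseteq> ?f ` (R \<times> T)"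
    proof clarify
      fix x assume "x \<in> M"
      then obtain r where r: "r \<in> R" "tproj ?S x = tproj ?S r" using R(3) by blast
      then have "x - r \<in> ?S" by (simp add: tproj_eq_iff S)
      then obtain h g where hg: "h \<in> H" "g \<in> G" "x - r = h + g" unfolding set_sum_def by blast
      obtain t where t: "t \<in> T" "tproj (H \<inter> G) h = tproj (H \<inter> G) t" using T(3) hg(1) by blast
      then have "h - t \<in> G" by (simp add: tproj_eq_iff I)
      then have "(h - t) + g \<in> G" using hg(2) add_subgroup_add[OF G(1)] by blast
      moreover have "(h - t) + g = x - (r + t)" using hg(3) by (simp add: algebra_simps)
      ultimately have "tproj G x = tproj G (r + t)" by (simp add: tproj_eq_iff G)
      then show "tproj G x \<in> ?f ` (R \<times> T)" using r(1) t(1) by force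
    qed
  qed
  with inj have f: "bij_betw ?f (R \<times> T) (tproj G ` M)" by (simp add: bij_betw_def)
  have "bij_betw (map_prod (tproj ?S) (tproj (H \<inter> G))) (R \<times> T) (tproj ?S ` M \<times> tproj (H \<inter> G) ` H)"
    using R(2,3) T(2,3) by (simp add: bij_betw_def map_prod_inj_on map_prod_surj_on)
  from bij_betw_trans[OF bij_betw_inv_into[OF this] f] show ?thesis by blast
qed

text \<open>Finiteness is recorded separately because \<open>card\<close> is 0 on infinite sets; the
  equivalence is later read from left to right, to pass finite index on to
  \<open>H \<inter> G\<close> in \<open>H\<close>.\<close>

lemma index_mult:
  fixes M :: "'a::euclidean_space set"
  assumes "add_subgroup M" "add_subgroup G" "G \<subseteq> M" "add_subgroup H" "H \<subseteq> M"
  shows "card (tproj G ` M) = card (tproj (set_sum H G) ` M) * card (tproj (H \<inter> G) ` H)"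
    and "finite (tproj G ` M) \<longleftrightarrow>
      finite (tproj (set_sum H G) ` M) \<and> finite (tproj (H \<inter> G) ` H)"
proof -
  obtain f where f: "bij_betw f (tproj (set_sum H G) ` M \<times> tproj (H \<inter> G) ` H) (tproj G ` M)"
    using coset_product_bij[OF assms] by blast
  show "card (tproj G ` M) = card (tproj (set_sum H G) ` M) * card (tproj (H \<inter> G) ` H)"
    using bij_betw_same_card[OF f] by (simp add: card_cartesian_product)
  \<comment> \<open>A finite product has finite factors only when neither factor is empty.\<close>
  have "M \<noteq> {}" "H \<noteq> {}" using assms add_subgroup_0 by auto
  then show "finite (tproj G ` M) \<longleftrightarrow>
      finite (tproj (set_sum H G) ` M) \<and> finite (tproj (H \<inter> G) ` H)"
    using bij_betw_finite[OF f] by (auto simp: finite_cartesian_product_iff)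
qed

text \<open>Pigeonhole: among the multiples of \<open>x\<close>, two lie in the same coset of
  \<open>G\<close>, so a nonzero multiple of \<open>x\<close> lies in \<open>G\<close>. Hence
  \<open>G\<close> and \<open>M\<close> have the same span.\<close>

lemma finite_index_dim:
  fixes M :: "'a::euclidean_space set"
  assumes M: "add_subgroup M" and G: "add_subgroup G" "G \<subseteq> M" and fin: "finite (tproj G ` M)"
  shows "dim G = dim M"
proof -
  have "x \<in> span G" if x: "x \<in> M" for x
  proof -
    have "\<not> inj_on (\<lambda>n::nat. tproj G (of_nat n *\<^sub>R x)) UNIV"
    proof
      assume "inj_on (\<lambda>n::nat. tproj G (of_nat n *\<^sub>R x)) UNIV"
      moreover have "range (\<lambda>n::nat. tproj G (of_nat n *\<^sub>R x)) \<subseteq> tproj G ` M"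
        using add_subgroup_scale_int[OF M x, of "int n" for n] by (auto intro!: imageI)
      ultimately show False
        using fin finite_subset finite_imageD by (metis infinite_UNIV_nat)
    qed
    then obtain m n :: nat where mn: "m \<noteq> n" "of_nat m *\<^sub>R x - of_nat n *\<^sub>R x \<in> G"
      by (auto simp: inj_on_def tproj_eq_iff G)
    then have "(real m - real n) *\<^sub>R x \<in> span G"
      by (simp add: scaleR_left_diff_distrib span_base)
    then have "inverse (real m - real n) *\<^sub>R (real m - real n) *\<^sub>R x \<in> span G"
      by (rule span_scale)
    then show ?thesis using mn(1) by simp
  qed
  then have "span G = span M"
    using G(2) by (meson span_eq span_superset subset_iff subset_trans)
  then show ?thesis by (metis dim_span)
qed

section \<open>Lattices, sublattices and volumes\<close>

lemma lattice_of_Nil: "lattice_of [] = {0}"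
  by (simp add: lattice_of_def)

lemma lattice_of_Cons:
  "x \<in> lattice_of (v # bs) \<longleftrightarrow> (\<exists>(n::int) w. w \<in> lattice_of bs \<and> x = of_int n *\<^sub>R v + w)"
proof
  assume "x \<in> lattice_of (v # bs)"
  then obtain c :: "nat \<Rightarrow> int"
    where "x = (\<Sum>i<length (v # bs). of_int (c i) *\<^sub>R ((v # bs) ! i))"
    unfolding lattice_of_def by blast
  then have "x = of_int (c 0) *\<^sub>R v + (\<Sum>i<length bs. of_int (c (Suc i)) *\<^sub>R (bs ! i))"
    by (simp add: sum.lessThan_Suc_shift del: sum.lessThan_Suc)
  moreover have "(\<Sum>i<length bs. of_int (c (Suc i)) *\<^sub>R (bs ! i)) \<in> lattice_of bs"
    unfolding lattice_of_def by (auto intro!: exI[of _ "\<lambda>i. c (Suc i)"])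
  ultimately show "\<exists>(n::int) w. w \<in> lattice_of bs \<and> x = of_int n *\<^sub>R v + w" by blast
next
  assume "\<exists>(n::int) w. w \<in> lattice_of bs \<and> x = of_int n *\<^sub>R v + w"
  then obtain n c where "x = of_int n *\<^sub>R v + (\<Sum>i<length bs. of_int (c i :: int) *\<^sub>R (bs ! i))"
    unfolding lattice_of_def by blast
  then have "x = (\<Sum>i<length (v # bs). of_int (case_nat n c i) *\<^sub>R ((v # bs) ! i))"
    by (simp add: sum.lessThan_Suc_shift del: sum.lessThan_Suc)
  then show "x \<in> lattice_of (v # bs)" unfolding lattice_of_def by blast
qed

lemma add_subgroup_lattice_of: "add_subgroup (lattice_of b)"
proof (induction b)
  case Nil
  then show ?case by (simp add: lattice_of_Nil add_subgroup_def)
next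
  case (Cons v bs)
  show ?case unfolding add_subgroup_def
  proof (intro conjI ballI)
    show "0 \<in> lattice_of (v # bs)"
      unfolding lattice_of_Cons using add_subgroup_0[OF Cons] by (intro exI[of _ 0]) auto
    fix x y assume "x \<in> lattice_of (v # bs)" "y \<in> lattice_of (v # bs)"
    then obtain m n :: int and a b where "a \<in> lattice_of bs" "b \<in> lattice_of bs"
      "x = of_int m *\<^sub>R v + a" "y = of_int n *\<^sub>R v + b"
      unfolding lattice_of_Cons by blast
    then have "a - b \<in> lattice_of bs" "x - y = of_int (m - n) *\<^sub>R v + (a - b)"
      using add_subgroup_diff[OF Cons] by (auto simp: algebra_simps)
    then show "x - y \<in> lattice_of (v # bs)" unfolding lattice_of_Cons by blast
  qed
qed

lemma lattice_of_subset_span: "lattice_of b \<subseteq> span (set b)"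
proof (induction b)
  case Nil
  then show ?case by (simp add: lattice_of_Nil)
next
  case (Cons v bs)
  have "w \<in> span (set (v # bs))" if "w \<in> lattice_of bs" for w
    using Cons that span_mono[of "set bs" "set (v # bs)"] by auto
  then show ?case
    by (force simp: lattice_of_Cons intro: span_add span_scale span_base)
qed

lemma set_subset_lattice_of: "set b \<subseteq> lattice_of b"
proof (induction b)
  case Nil
  then show ?case by simp
next
  case (Cons v bs)
  have "v \<in> lattice_of (v # bs)"
    unfolding lattice_of_Cons using add_subgroup_0[OF add_subgroup_lattice_of[of bs]]
    by (intro exI[of _ 1]) auto
  moreover have "w \<in> lattice_of (v # bs)" if "w \<in> set bs" for w
    unfolding lattice_of_Cons using Cons that by (intro exI[of _ 0] exI[of _ w]) auto
  ultimately show ?case by auto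
qed

lemma lattice_of_mono_Cons: "lattice_of bs \<subseteq> lattice_of (v # bs)"
proof
  fix w assume "w \<in> lattice_of bs"
  then show "w \<in> lattice_of (v # bs)"
    unfolding lattice_of_Cons by (intro exI[of _ 0] exI[of _ w]) auto
qed

section \<open>Rank and volume do not depend on the chosen basis\<close>

lemma dim_lattice:
  assumes "lattice_basis_of L b"
  shows "dim L = length b"
proof -
  have "span L = span (set b)"
    using assms lattice_of_subset_span[of b] set_subset_lattice_of[of b]
    unfolding lattice_basis_of_def by (meson span_eq span_superset subset_iff)
  then have "dim L = dim (set b)" by (metis dim_span)
  also have "\<dots> = length b"
    using assms unfolding lattice_basis_of_def by (simp add: dim_eq_card_independent distinct_card)
  finally show ?thesis .
qed

text \<open>With \<open>B\<close> the matrix of coefficients, the Gram matrices satisfy Gram(c) = B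
  Gram(b) B^T, and determinants are multiplicative. The integrality of the coefficients is kept in
  the statement: it gives unimodularity for two bases of one lattice and an index for a
  sublattice.\<close>

lemma gram_det_change_basis:
  fixes a :: "nat \<Rightarrow> nat \<Rightarrow> int"
  assumes len: "length b = n" "length c = n"
    and c: "\<And>i. i < n \<Longrightarrow> c ! i = (\<Sum>j<n. of_int (a i j) *\<^sub>R (b ! j))"
  shows "gram_det c = (of_int (det (mat n n (\<lambda>(i, j). a i j))))\<^sup>2 * gram_det b"
proof -
  define A where "A = mat n n (\<lambda>(i, j). a i j)"
  define B where "B = (map_mat of_int A :: real mat)"
  define gram where "gram = (\<lambda>b::'a list. mat n n (\<lambda>(i, j). inner (b ! i) (b ! j)))"
  have gram_det: "gram_det b' = det (gram b')" if "length b' = n" for b' :: "'a list"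
  proof -
    have "det (gram b') = (\<Sum>\<pi> | \<pi> permutes {0..<n}.
        of_int (sign \<pi>) * (\<Prod>i = 0..<n. gram b' $$ (i, \<pi> i)))"
      by (rule det_def') (simp add: gram_def)
    also have "\<dots> = (\<Sum>\<pi> | \<pi> permutes {0..<n}.
        of_int (sign \<pi>) * (\<Prod>i = 0..<n. inner (b' ! i) (b' ! \<pi> i)))"
    proof (intro sum.cong refl arg_cong[where f = "\<lambda>x. _ * x"] prod.cong)
      fix \<pi> i assume "\<pi> \<in> {\<pi>. \<pi> permutes {0..<n}}" "i \<in> {0..<n}"
      then have "\<pi> i < n" "i < n" using permutes_in_image[of \<pi> "{0..<n}" i] by auto
      then show "gram b' $$ (i, \<pi> i) = inner (b' ! i) (b' ! \<pi> i)" by (simp add: gram_def)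
    qed
    finally show ?thesis unfolding gram_det_def that by (simp add: atLeast0LessThan)
  qed
  have B: "B \<in> carrier_mat n n" by (simp add: B_def A_def)
  have gb: "gram b \<in> carrier_mat n n" by (simp add: gram_def)
  have "gram c = B * gram b * B\<^sup>T"
  proof (rule eq_matI)
    fix i j assume "i < dim_row (B * gram b * B\<^sup>T)" "j < dim_col (B * gram b * B\<^sup>T)"
    then have ij: "i < n" "j < n" using B by auto
    have "inner (c ! i) (c ! j) =
        (\<Sum>l<n. (\<Sum>k<n. of_int (a i k) * inner (b ! k) (b ! l)) * of_int (a j l))"
      unfolding c[OF ij(1)] c[OF ij(2)]
      by (simp add: inner_sum_left inner_sum_right sum_distrib_left sum_distrib_right mult_ac)
    then show "gram c $$ (i, j) = (B * gram b * B\<^sup>T) $$ (i, j)"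
      using ij by (simp add: gram_def B_def A_def scalar_prod_def atLeast0LessThan)
  qed (use B in \<open>auto simp: gram_def\<close>)
  then have "det (gram c) = det B * det (gram b) * det (B\<^sup>T)"
    using B gb det_mult[of "B * gram b" n "B\<^sup>T"] det_mult[of B n "gram b"] by simp
  also have "\<dots> = (det B)\<^sup>2 * det (gram b)"
    using det_transpose[OF B] by (simp add: power2_eq_square)
  also have "det B = of_int (det A)" unfolding B_def by (rule of_int_hom.hom_det)
  finally show ?thesis by (simp add: gram_det len A_def)
qed

lemma lattice_coords:
  assumes "set c \<subseteq> lattice_of b"
  obtains a :: "nat \<Rightarrow> nat \<Rightarrow> int"
  where "\<And>i. i < length c \<Longrightarrow> c ! i = (\<Sum>j<length b. of_int (a i j) *\<^sub>R (b ! j))"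
proof -
  have "\<exists>z::nat \<Rightarrow> int. c ! i = (\<Sum>j<length b. of_int (z j) *\<^sub>R (b ! j))" if "i < length c" for i
    using assms nth_mem[OF that] unfolding lattice_of_def by blast
  then show ?thesis using that by metis
qed

text \<open>Both transition matrices are integral, so their determinants multiply to \<open>\<plusminus>1\<close>
  unless both Gram determinants vanish.\<close>
lemma gram_det_unique:
  assumes "lattice_basis_of L b" "lattice_basis_of L c"
  shows "gram_det b = gram_det c"
proof -
  have len: "length c = length b" using dim_lattice assms by metis
  have "lattice_of b = lattice_of c" using assms by (simp add: lattice_basis_of_def)
  then have sub: "set c \<subseteq> lattice_of b" "set b \<subseteq> lattice_of c"
    using set_subset_lattice_of by metis+
  obtain a where a: "\<And>i. i < length c \<Longrightarrow> c ! i = (\<Sum>j<length b. of_int (a i j :: int) *\<^sub>R (b ! j))"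
    using lattice_coords[OF sub(1)] by blast
  obtain a' where a': "\<And>i. i < length b \<Longrightarrow> b ! i = (\<Sum>j<length c. of_int (a' i j :: int) *\<^sub>R (c ! j))"
    using lattice_coords[OF sub(2)] by blast
  obtain d e :: int where d: "gram_det c = (of_int d)\<^sup>2 * gram_det b"
    and e: "gram_det b = (of_int e)\<^sup>2 * gram_det c"
    using gram_det_change_basis[OF refl len a[unfolded len]]
      gram_det_change_basis[OF len refl a'[unfolded len]] by blast
  show ?thesis
  proof (cases "gram_det b = 0")
    case False
    have "gram_det b = of_int ((d * e)\<^sup>2) * gram_det b"
      by (subst e, subst d) (simp add: power_mult_distrib)
    with False have "of_int ((d * e)\<^sup>2) = (1::real)" by simp
    then have "(d * e)\<^sup>2 = 1" by linarith
    \<comment> \<open>Here integrality enters: \<open>d\<close> divides 1, hence is a unit of the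
      integers.\<close>
    then have "1 = d * (e * (d * e))" by (simp add: power2_eq_square mult_ac)
    then have "\<bar>d\<bar> = 1" using dvdI zdvd1_eq by blast
    then have "(of_int d :: real)\<^sup>2 = 1" by (auto simp: abs_if split: if_splits)
    then show ?thesis using d by simp
  qed (use d in simp)
qed

text \<open>Removes the choice operator from \<open>lattice_vol\<close>: any convenient basis
  computes the volume.\<close>

lemma lattice_vol_eq:
  assumes "lattice_basis_of L b"
  shows "lattice_vol L = sqrt (gram_det b)"
  unfolding lattice_vol_def lattice_basis_def
  using gram_det_unique[OF someI[of "lattice_basis_of L", OF assms] assms] by simp

lemma lattice_dim_eq:
  assumes "is_lattice L p"
  shows "lattice_dim L = p" and "dim L = p"
proof -
  obtain b where b: "lattice_basis_of L b" "length b = p" using assms unfolding is_lattice_def by blast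
  show "dim L = p" using dim_lattice[OF b(1)] b(2) by simp
  then show "lattice_dim L = p"
    unfolding lattice_dim_def lattice_basis_def
    using dim_lattice[OF someI[of "lattice_basis_of L", OF b(1)]] by simp
qed

lemma is_lattice_add_subgroup: "is_lattice L p \<Longrightarrow> add_subgroup L"
  unfolding is_lattice_def lattice_basis_of_def using add_subgroup_lattice_of by auto

section \<open>Triangular bases of subgroups, and the index as a determinant\<close>

text \<open>The coefficients of \<open>v\<close> occurring in elements of \<open>G\<close> form an
  ideal of the integers (the predicate \<open>I\<close>). It is either zero, or generated by its
  least positive member \<open>k\<close>, and \<open>of_int k *\<^sub>R v + w\<close> is an element
  of \<open>G\<close> realizing it.\<close>

lemma subgroup_lattice_Cons_cases:
  fixes v :: "'a::euclidean_space"
  assumes G: "add_subgroup G" "G \<subseteq> lattice_of (v # bs)"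
  obtains (lower) "G \<subseteq> lattice_of bs"
  | (pivot) k :: int and w where "k > 0" "w \<in> lattice_of bs" "of_int k *\<^sub>R v + w \<in> G"
      "\<forall>n y. y \<in> lattice_of bs \<longrightarrow> of_int n *\<^sub>R v + y \<in> G \<longrightarrow> k dvd n"
proof -
  define I where "I = (\<lambda>n::int. \<exists>y\<in>lattice_of bs. of_int n *\<^sub>R v + y \<in> G)"
  note L = add_subgroup_lattice_of[of bs]
  have diff: "I (m - q * n)" if mn: "I m" "I n" for m n q
  proof -
    obtain y z where y: "y \<in> lattice_of bs" "of_int m *\<^sub>R v + y \<in> G"
      and z: "z \<in> lattice_of bs" "of_int n *\<^sub>R v + z \<in> G"
      using mn unfolding I_def by blast
    have "y - of_int q *\<^sub>R z \<in> lattice_of bs"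
      using add_subgroup_diff[OF L y(1) add_subgroup_scale_int[OF L z(1)]] .
    moreover have "(of_int m *\<^sub>R v + y) - of_int q *\<^sub>R (of_int n *\<^sub>R v + z) \<in> G"
      using add_subgroup_diff[OF G(1) y(2) add_subgroup_scale_int[OF G(1) z(2)]] .
    moreover have "(of_int m *\<^sub>R v + y) - of_int q *\<^sub>R (of_int n *\<^sub>R v + z)
        = of_int (m - q * n) *\<^sub>R v + (y - of_int q *\<^sub>R z)"
      by (simp add: algebra_simps)
    ultimately show ?thesis unfolding I_def by metis
  qed
  show ?thesis
  proof (cases "\<forall>n. I n \<longrightarrow> n = 0")
    case True
    have "G \<subseteq> lattice_of bs"
    proof
      fix x assume x: "x \<in> G"
      then obtain n :: int and y where y: "y \<in> lattice_of bs" "x = of_int n *\<^sub>R v + y"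
        using G(2) lattice_of_Cons by blast
      then have "n = 0" using True x unfolding I_def by blast
      then show "x \<in> lattice_of bs" using y by simp
    qed
    then show ?thesis by (rule lower)
  next
    case False
    then obtain n where n: "I n" "n \<noteq> 0" by blast
    \<comment> \<open>This is \<open>- n\<close>, so a positive coefficient exists whatever the sign
      of \<open>n\<close>.\<close>
    have "I (n - 2 * n)" using diff[OF n(1) n(1)] .
    then have "I \<bar>n\<bar>" using n(1) by (auto simp: abs_if)
    then have ex: "\<exists>k::nat. k > 0 \<and> I (int k)" using n(2) by (intro exI[of _ "nat \<bar>n\<bar>"]) auto
    define k where "k = (LEAST k::nat. k > 0 \<and> I (int k))"
    have "k > 0 \<and> I (int k)" unfolding k_def by (rule LeastI_ex[OF ex])
    then have k: "k > 0" "I (int k)" by blast+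
    have dvd: "int k dvd m" if "I m" for m
    proof (rule ccontr)
      assume "\<not> int k dvd m"
      then have "m mod int k \<noteq> 0" by (simp add: mod_eq_0_iff_dvd)
      moreover have "0 \<le> m mod int k" "m mod int k < int k" using k(1) by simp_all
      ultimately have pos: "0 < m mod int k" "m mod int k < int k" by linarith+
      \<comment> \<open>Euclidean division: the remainder is again a coefficient, positive and below
        the least one.\<close>
      have "I (m - m div int k * int k)" using diff[OF that k(2)] .
      then have "I (int (nat (m mod int k)))" using pos by (simp add: minus_div_mult_eq_mod)
      then have "k \<le> nat (m mod int k)" using pos(1) Least_le[of "\<lambda>k. k > 0 \<and> I (int k)" "nat (m mod int k)"]
        by (simp add: k_def[symmetric])
      then show False using pos by linarith
    qed
    obtain w where "w \<in> lattice_of bs" "of_int (int k) *\<^sub>R v + w \<in> G"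
      using k(2) unfolding I_def by blast
    then show ?thesis using dvd k(1) by (intro pivot[of "int k" w]) (auto simp: I_def)
  qed
qed

text \<open>Subtracting the right multiple of the pivot from an element of \<open>G\<close> kills
  its \<open>v\<close>-coefficient, which leaves an element of
  \<open>G \<inter> lattice_of bs\<close>. The pivot is independent of \<open>cs\<close> because its
  \<open>v\<close>-coefficient \<open>k\<close> is nonzero while \<open>cs\<close> lies in the span
  of \<open>bs\<close>.\<close>

lemma lattice_basis_of_pivot:
  fixes v :: "'a::euclidean_space"
  assumes v: "v \<notin> span (set bs)" and G: "add_subgroup G" "G \<subseteq> lattice_of (v # bs)"
    and k: "k > 0" and w: "w \<in> lattice_of bs" and g: "of_int k *\<^sub>R v + w \<in> G"
    and dvd: "\<forall>n y. y \<in> lattice_of bs \<longrightarrow> of_int n *\<^sub>R v + y \<in> G \<longrightarrow> k dvd n"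
    and cs: "lattice_basis_of (G \<inter> lattice_of bs) cs"
  shows "lattice_basis_of G ((of_int k *\<^sub>R v + w) # cs)"
proof -
  let ?g = "of_int k *\<^sub>R v + w"
  note L = add_subgroup_lattice_of[of bs]
  have csG: "lattice_of cs = G \<inter> lattice_of bs" using cs by (simp add: lattice_basis_of_def)
  have "set cs \<subseteq> span (set bs)"
    using set_subset_lattice_of[of cs] lattice_of_subset_span[of bs] csG by blast
  then have sub: "span (set cs) \<subseteq> span (set bs)" by (simp add: span_minimal)
  have g_span: "?g \<notin> span (set cs)"
  proof
    assume "?g \<in> span (set cs)"
    then have "?g - w \<in> span (set bs)"
      using sub w lattice_of_subset_span[of bs] by (meson span_diff subsetD)
    then have "of_int k *\<^sub>R v \<in> span (set bs)" by simp
    then have "inverse (of_int k) *\<^sub>R (of_int k *\<^sub>R v) \<in> span (set bs)"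
      by (rule span_scale)
    moreover have "inverse (of_int k) *\<^sub>R (of_int k *\<^sub>R v) = v" using k by simp
    ultimately show False using v by simp
  qed
  have "G = lattice_of (?g # cs)"
  proof
    show "G \<subseteq> lattice_of (?g # cs)"
    proof
      fix x assume x: "x \<in> G"
      then obtain n :: int and y where y: "y \<in> lattice_of bs" "x = of_int n *\<^sub>R v + y"
        using G(2) lattice_of_Cons by blast
      then obtain q where q: "n = k * q" using dvd x by (metis dvdE)
      have "x - of_int q *\<^sub>R ?g = y - of_int q *\<^sub>R w"
        using y q by (simp add: algebra_simps)
      moreover have "x - of_int q *\<^sub>R ?g \<in> G"
        using add_subgroup_diff[OF G(1) x add_subgroup_scale_int[OF G(1) g]] .
      moreover have "y - of_int q *\<^sub>R w \<in> lattice_of bs"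
        using add_subgroup_diff[OF L y(1) add_subgroup_scale_int[OF L w]] .
      ultimately have "x - of_int q *\<^sub>R ?g \<in> lattice_of cs" using csG by simp
      then show "x \<in> lattice_of (?g # cs)"
        unfolding lattice_of_Cons by (metis add.commute diff_add_cancel)
    qed
    show "lattice_of (?g # cs) \<subseteq> G"
    proof
      fix x assume "x \<in> lattice_of (?g # cs)"
      then obtain n :: int and y where "y \<in> lattice_of cs" "x = of_int n *\<^sub>R ?g + y"
        unfolding lattice_of_Cons by blast
      then show "x \<in> G"
        using csG add_subgroup_add[OF G(1) add_subgroup_scale_int[OF G(1) g]] by simp
    qed
  qed
  moreover have "?g \<notin> set cs" using g_span span_base by blast
  ultimately show ?thesis
    using cs g_span by (simp add: lattice_basis_of_def independent_insert)
qed

text \<open>Covers subgroups of every rank, as period lattices require: the case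
  \<open>lower\<close> skips \<open>v\<close>, the case \<open>pivot\<close> adds one basis
  vector.\<close>

lemma subgroup_lattice_basis:
  fixes b :: "'a::euclidean_space list"
  assumes "distinct b" "independent (set b)" "add_subgroup G" "G \<subseteq> lattice_of b"
  shows "\<exists>c. lattice_basis_of G c"
  using assms
proof (induction b arbitrary: G)
  case Nil
  then have "G = lattice_of []" using add_subgroup_0 by (auto simp: lattice_of_Nil)
  then have "lattice_basis_of G []" by (simp add: lattice_basis_of_def independent_empty)
  then show ?case by blast
next
  case (Cons v bs)
  have bs: "distinct bs" "independent (set bs)" and v: "v \<notin> span (set bs)"
    using Cons.prems by (auto simp: independent_insert)
  from Cons.prems(3,4) show ?case
  proof (cases rule: subgroup_lattice_Cons_cases)
    case lower
    then show ?thesis using Cons.IH[OF bs Cons.prems(3)] by blast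
  next
    case (pivot k w)
    obtain cs where cs: "lattice_basis_of (G \<inter> lattice_of bs) cs"
      using Cons.IH[OF bs add_subgroup_Int[OF Cons.prems(3) add_subgroup_lattice_of]] by blast
    then show ?thesis using lattice_basis_of_pivot[OF v Cons.prems(3,4) pivot cs] by blast
  qed
qed

text \<open>The instance \<open>H = lattice_of bs\<close> of \<open>index_mult\<close>. The outer
  factor is \<open>k\<close>, since the multiples \<open>0, v, ..., (k - 1) v\<close> represent the
  cosets of \<open>lattice_of bs + G\<close>.\<close>

lemma index_pivot:
  fixes v :: "'a::euclidean_space"
  assumes G: "add_subgroup G" "G \<subseteq> lattice_of (v # bs)"
    and k: "k > 0" and w: "w \<in> lattice_of bs" and g: "of_int k *\<^sub>R v + w \<in> G"
    and dvd: "\<forall>n y. y \<in> lattice_of bs \<longrightarrow> of_int n *\<^sub>R v + y \<in> G \<longrightarrow> k dvd n"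
    and fin: "finite (tproj (G \<inter> lattice_of bs) ` lattice_of bs)"
  shows "finite (tproj G ` lattice_of (v # bs))"
    and "card (tproj G ` lattice_of (v # bs)) = nat k * card (tproj (G \<inter> lattice_of bs) ` lattice_of bs)"
proof -
  let ?S = "set_sum (lattice_of bs) G" and ?M = "lattice_of (v # bs)"
  note L = add_subgroup_lattice_of[of bs]
  have S: "add_subgroup ?S" by (rule add_subgroup_set_sum[OF L G(1)])
  have eq: "tproj ?S ` ?M = (\<lambda>j::int. tproj ?S (of_int j *\<^sub>R v)) ` {0..<k}"
  proof (intro equalityI subsetI)
    fix C assume "C \<in> tproj ?S ` ?M"
    then obtain n :: int and y where y: "y \<in> lattice_of bs" and C: "C = tproj ?S (of_int n *\<^sub>R v + y)"
      unfolding lattice_of_Cons image_iff Bex_def by blast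
    \<comment> \<open>Taking away \<open>n div k\<close> copies of the pivot and everything in
      \<open>lattice_of bs\<close> reduces \<open>n\<close> to \<open>n mod k\<close>.\<close>
    have "(y - of_int (n div k) *\<^sub>R w) + of_int (n div k) *\<^sub>R (of_int k *\<^sub>R v + w) \<in> ?S"
      unfolding set_sum_def
      using add_subgroup_diff[OF L y add_subgroup_scale_int[OF L w]] add_subgroup_scale_int[OF G(1) g]
      by blast
    also have "(y - of_int (n div k) *\<^sub>R w) + of_int (n div k) *\<^sub>R (of_int k *\<^sub>R v + w)
        = y + of_int (n div k * k) *\<^sub>R v" by (simp add: algebra_simps)
    also have "n div k * k = n - n mod k" by (simp add: minus_mod_eq_div_mult)
    finally have "(of_int n *\<^sub>R v + y) - of_int (n mod k) *\<^sub>R v \<in> ?S" by (simp add: algebra_simps)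
    then have "C = tproj ?S (of_int (n mod k) *\<^sub>R v)" unfolding C by (simp add: tproj_eq_iff[OF S])
    then show "C \<in> (\<lambda>j::int. tproj ?S (of_int j *\<^sub>R v)) ` {0..<k}" using k by auto
  next
    fix C assume "C \<in> (\<lambda>j::int. tproj ?S (of_int j *\<^sub>R v)) ` {0..<k}"
    then show "C \<in> tproj ?S ` ?M"
      using add_subgroup_scale_int[OF add_subgroup_lattice_of, of v "v # bs"]
        set_subset_lattice_of[of "v # bs"] by auto
  qed
  have "inj_on (\<lambda>j::int. tproj ?S (of_int j *\<^sub>R v)) {0..<k}"
  proof (rule inj_onI)
    fix i j assume ij: "i \<in> {0..<k}" "j \<in> {0..<k}"
      and "tproj ?S (of_int i *\<^sub>R v) = tproj ?S (of_int j *\<^sub>R v)"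
    then have "of_int (i - j) *\<^sub>R v \<in> ?S" by (simp add: tproj_eq_iff[OF S] algebra_simps)
    then obtain y h where y: "y \<in> lattice_of bs" and h: "h \<in> G" and "of_int (i - j) *\<^sub>R v = y + h"
      unfolding set_sum_def by blast
    then have "of_int (i - j) *\<^sub>R v + (- y) \<in> G" by simp
    then have "k dvd i - j" using dvd add_subgroup_minus[OF L y] by blast
    then have "i mod k = j mod k" by (simp add: mod_eq_dvd_iff)
    then show "i = j" using ij by simp
  qed
  then have card: "card (tproj ?S ` ?M) = nat k" unfolding eq by (simp add: card_image)
  have sub: "lattice_of bs \<subseteq> ?M" by (rule lattice_of_mono_Cons)
  note im = index_mult[OF add_subgroup_lattice_of G L sub]
  show "finite (tproj G ` ?M)" using im(2) fin eq by (simp add: Int_commute)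
  show "card (tproj G ` ?M) = nat k * card (tproj (G \<inter> lattice_of bs) ` lattice_of bs)"
    using im(1) card by (simp add: Int_commute)
qed

text \<open>A Hermite normal form without reduction of the off-diagonal entries. Each diagonal entry
  is a pivot, and \<open>index_pivot\<close> turns each pivot into a factor of the index.\<close>

lemma sublattice_triangular_basis:
  fixes b :: "'a::euclidean_space list"
  assumes "distinct b" "independent (set b)" "add_subgroup G" "G \<subseteq> lattice_of b" "dim G = length b"
  shows "\<exists>c a. lattice_basis_of G c \<and> length c = length b \<and>
    (\<forall>i<length b. c ! i = (\<Sum>j<length b. of_int (a i j) *\<^sub>R (b ! j))) \<and>
    (\<forall>i j. j < i \<longrightarrow> a i j = (0::int)) \<and> finite (tproj G ` lattice_of b) \<and>
    (\<Prod>i<length b. a i i) = int (card (tproj G ` lattice_of b))"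
  using assms
proof (induction b arbitrary: G)
  case Nil
  then have "G = lattice_of []" using add_subgroup_0 by (auto simp: lattice_of_Nil)
  then have "lattice_basis_of G []" by (simp add: lattice_basis_of_def independent_empty)
  then show ?case by (intro exI[of _ "[]"] exI[of _ "\<lambda>_ _. 0"]) (simp add: lattice_of_Nil)
next
  case (Cons v bs)
  have bs: "distinct bs" "independent (set bs)" and v: "v \<notin> span (set bs)"
    using Cons.prems by (auto simp: independent_insert)
  from Cons.prems(3,4) show ?case
  proof (cases rule: subgroup_lattice_Cons_cases)
    \<comment> \<open>Full rank excludes a missing pivot: \<open>G\<close> would have dimension at
      most \<open>length bs\<close>.\<close>
    case lower
    then have "dim G \<le> dim (lattice_of bs)" by (rule dim_subset)
    also have "\<dots> = length bs" using bs by (intro dim_lattice) (simp add: lattice_basis_of_def)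
    finally show ?thesis using Cons.prems(5) by simp
  next
    case (pivot k w)
    let ?G' = "G \<inter> lattice_of bs" and ?g = "of_int k *\<^sub>R v + w"
    have G': "add_subgroup ?G'" by (intro add_subgroup_Int Cons.prems add_subgroup_lattice_of)
    obtain cs0 where cs0: "lattice_basis_of ?G' cs0"
      using subgroup_lattice_basis[OF bs G'] by blast
    \<comment> \<open>The pivot extends any basis of \<open>?G'\<close> to one of \<open>G\<close>,
      so the ranks differ by exactly one and the induction hypothesis applies.\<close>
    have "dim ?G' = length bs"
      using dim_lattice[OF cs0] dim_lattice[OF lattice_basis_of_pivot[OF v Cons.prems(3,4) pivot cs0]]
        Cons.prems(5) by simp
    from Cons.IH[OF bs G' _ this] obtain cs a where cs: "lattice_basis_of ?G' cs" "length cs = length bs"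
      and a: "\<forall>i<length bs. cs ! i = (\<Sum>j<length bs. of_int (a i j) *\<^sub>R (bs ! j))"
        "\<forall>i j. j < i \<longrightarrow> a i j = (0::int)" "finite (tproj ?G' ` lattice_of bs)"
        "(\<Prod>i<length bs. a i i) = int (card (tproj ?G' ` lattice_of bs))"
      by auto
    obtain z :: "nat \<Rightarrow> int" where z: "w = (\<Sum>j<length bs. of_int (z j) *\<^sub>R (bs ! j))"
      using pivot(2) unfolding lattice_of_def by blast
    \<comment> \<open>The first row holds the coordinates \<open>k, z\<close> of the pivot; the
      later rows are those of \<open>a\<close> shifted behind a leading 0.\<close>
    define a' where "a' = case_nat (case_nat k z) (\<lambda>i. case_nat 0 (a i))"
    note sh = sum.lessThan_Suc_shift prod.lessThan_Suc_shift
    have "(?g # cs) ! i = (\<Sum>j<length (v # bs). of_int (a' i j) *\<^sub>R ((v # bs) ! j))"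
      if "i < length (v # bs)" for i
      using that z a(1)
      by (cases i) (simp_all add: a'_def sh del: sum.lessThan_Suc)
    moreover have "a' i j = 0" if "j < i" for i j
      using that a(2) by (cases i; cases j) (auto simp: a'_def)
    moreover have "(\<Prod>i<length (v # bs). a' i i) = int (card (tproj G ` lattice_of (v # bs)))"
      using index_pivot(2)[OF Cons.prems(3,4) pivot a(3)] a(4) pivot(1)
      by (simp add: a'_def sh del: prod.lessThan_Suc)
    moreover have "finite (tproj G ` lattice_of (v # bs))"
      by (rule index_pivot(1)[OF Cons.prems(3,4) pivot a(3)])
    ultimately show ?thesis
      using lattice_basis_of_pivot[OF v Cons.prems(3,4) pivot cs(1)] cs(2)
      by (intro exI[of _ "?g # cs"] exI[of _ a']) simp
  qed
qed

lemma subgroup_is_lattice: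
  assumes "is_lattice M p" "add_subgroup G" "G \<subseteq> M"
  shows "is_lattice G (dim G)"
proof -
  obtain b where "lattice_basis_of M b" using assms unfolding is_lattice_def by blast
  then obtain c where "lattice_basis_of G c"
    using subgroup_lattice_basis assms(2,3) unfolding lattice_basis_of_def by metis
  then show ?thesis using dim_lattice unfolding is_lattice_def by metis
qed

text \<open>The transition matrix to a triangular basis has the index as its determinant, so the
  Gram determinant scales by the squared index and the volume by the index itself.\<close>

lemma sublattice_index:
  fixes M :: "'a::euclidean_space set"
  assumes "is_lattice M p" "add_subgroup G" "G \<subseteq> M" "dim G = p"
  shows "finite (tproj G ` M)"
    and "lattice_vol G = real (card (tproj G ` M)) * lattice_vol M"
proof -
  obtain b where b: "lattice_basis_of M b" "length b = p"
    using assms unfolding is_lattice_def by blast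
  then have M: "M = lattice_of b" by (simp add: lattice_basis_of_def)
  obtain c a where c: "lattice_basis_of G c" "length c = length b"
    and a: "\<And>i. i < length b \<Longrightarrow> c ! i = (\<Sum>j<length b. of_int (a i j) *\<^sub>R (b ! j))"
      "\<And>i j. j < i \<Longrightarrow> a i j = (0::int)"
    and fin: "finite (tproj G ` M)" and prod: "(\<Prod>i<length b. a i i) = int (card (tproj G ` M))"
    using sublattice_triangular_basis[of b G] assms b unfolding lattice_basis_of_def by auto
  show "finite (tproj G ` M)" by (rule fin)
  let ?A = "mat (length b) (length b) (\<lambda>(i, j). a i j)"
  have "det ?A = prod_list (diag_mat ?A)"
    by (rule det_upper_triangular) (auto simp: a(2))
  also have "\<dots> = (\<Prod>i<length b. a i i)" by (simp add: prod_list_diag_prod atLeast0LessThan)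
  finally have "det ?A = int (card (tproj G ` M))" using prod by simp
  with gram_det_change_basis[OF refl c(2) a(1)]
  have "gram_det c = (real (card (tproj G ` M)))\<^sup>2 * gram_det b" by simp
  then show "lattice_vol G = real (card (tproj G ` M)) * lattice_vol M"
    using lattice_vol_eq[OF c(1)] lattice_vol_eq[OF b(1)] by (simp add: real_sqrt_mult)
qed

section \<open>Quotient topologies and tori\<close>

text \<open>The constructor \<open>topology\<close> returns the given open sets only once
  \<open>istopology\<close> has been verified for them.\<close>

lemma openin_quotient_topology:
  "openin (quotient_topology X f) U \<longleftrightarrow>
    U \<subseteq> f ` topspace X \<and> openin X {x \<in> topspace X. f x \<in> U}"
proof -
  have "istopology (\<lambda>U. U \<subseteq> f ` topspace X \<and> openin X {x \<in> topspace X. f x \<in> U})"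
    unfolding istopology_def
  proof (intro conjI allI impI; (elim conjE)?)
    fix S T assume "openin X {x \<in> topspace X. f x \<in> S}" "openin X {x \<in> topspace X. f x \<in> T}"
    then have "openin X ({x \<in> topspace X. f x \<in> S} \<inter> {x \<in> topspace X. f x \<in> T})"
      by (rule openin_Int)
    also have "{x \<in> topspace X. f x \<in> S} \<inter> {x \<in> topspace X. f x \<in> T} = {x \<in> topspace X. f x \<in> S \<inter> T}"
      by auto
    finally show "openin X {x \<in> topspace X. f x \<in> S \<inter> T}" .
  next
    fix \<U> assume "\<forall>S\<in>\<U>. S \<subseteq> f ` topspace X \<and> openin X {x \<in> topspace X. f x \<in> S}"
    then have "openin X (\<Union>S\<in>\<U>. {x \<in> topspace X. f x \<in> S})" by blast
    also have "(\<Union>S\<in>\<U>. {x \<in> topspace X. f x \<in> S}) = {x \<in> topspace X. f x \<in> \<Union>\<U>}" by auto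
    finally show "openin X {x \<in> topspace X. f x \<in> \<Union>\<U>}" .
  qed auto
  then show ?thesis unfolding quotient_topology_def by (simp add: topology_inverse')
qed

lemma quotient_map_quotient_topology: "quotient_map X (quotient_topology X f) f"
proof -
  have "openin (quotient_topology X f) (f ` topspace X)"
    unfolding openin_quotient_topology by (auto intro: openin_subopen[THEN iffD2])
  then have "topspace (quotient_topology X f) = f ` topspace X"
    using openin_topspace[of "quotient_topology X f"]
    unfolding openin_quotient_topology[of X f "topspace (quotient_topology X f)"]
    by (intro equalityI) (auto dest: openin_subset)
  then show ?thesis unfolding quotient_map_def openin_quotient_topology by auto
qed

lemma topspace_quotient_topology: "topspace (quotient_topology X f) = f ` topspace X"
  using quotient_map_quotient_topology quotient_imp_surjective_map by metis

lemma quotient_map_torus: "quotient_map euclidean (torus L) (tproj L)"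
  unfolding torus_def by (rule quotient_map_quotient_topology)

lemma topspace_torus: "topspace (torus L) = range (tproj L)"
  unfolding torus_def topspace_quotient_topology by simp

lemma tproj_mem_image_iff:
  assumes "add_subgroup L"
  shows "tproj L y \<in> tproj L ` A \<longleftrightarrow> (\<exists>u\<in>L. y + u \<in> A)"
proof
  assume "tproj L y \<in> tproj L ` A"
  then obtain a where a: "a \<in> A" "y - a \<in> L" by (auto simp: tproj_eq_iff[OF assms])
  then show "\<exists>u\<in>L. y + u \<in> A"
    using add_subgroup_minus[OF assms a(2)] by (intro bexI[of _ "- (y - a)"]) auto
next
  assume "\<exists>u\<in>L. y + u \<in> A"
  then obtain u where u: "u \<in> L" "y + u \<in> A" by blast
  then have "y - (y + u) \<in> L" using add_subgroup_minus[OF assms u(1)] by simp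
  then have "tproj L y = tproj L (y + u)" by (simp add: tproj_eq_iff[OF assms])
  then show "tproj L y \<in> tproj L ` A" using u by blast
qed

text \<open>Counts the points of a fibre as cosets: both are images of one lattice, and only the
  relations of having equal images need comparing.\<close>

lemma card_image_eq_of_kernel_eq:
  assumes "\<And>a b. a \<in> A \<Longrightarrow> b \<in> A \<Longrightarrow> f a = f b \<longleftrightarrow> g a = g b"
  shows "card (f ` A) = card (g ` A)"
proof (rule bij_betw_same_card)
  let ?h = "\<lambda>c. g (inv_into A f c)"
  have h: "?h (f a) = g a" if "a \<in> A" for a
    using assms[of "inv_into A f (f a)" a] that by (simp add: inv_into_into f_inv_into_f)
  then show "bij_betw ?h (f ` A) (g ` A)"
    unfolding bij_betw_def inj_on_def using assms by (auto simp: h image_iff)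
qed

section \<open>Vanishing interleaving distance, and translations of tori and trees\<close>

lemma dI_nonneg: "0 \<le> dI M M'"
  unfolding dI_def by (intro Inf_greatest) (auto simp: compatible_def)

lemma dI_eq_0I:
  assumes "compatible 0 M M' \<phi> \<psi>"
  shows "dI M M' = 0"
proof (rule antisym[OF _ dI_nonneg])
  show "dI M M' \<le> 0"
    unfolding dI_def using assms by (intro Inf_lower) (auto simp: zero_ereal_def)
qed

lemma mono_le_refl: "mono_le m m"
  by (simp add: mono_le_def)

lemma dI_refl: "dI M M = 0"
  by (rule dI_eq_0I[of _ _ id id]) (auto simp: compatible_def covers_def mono_le_refl)

text \<open>One formula for two maps. On cosets of \<open>L0 \<subseteq> L\<close>, adding
  \<open>L\<close> absorbs \<open>L0\<close>, so \<open>u = 0\<close> gives the covering of the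
  \<open>L\<close>-torus by the \<open>L0\<close>-torus, while \<open>L0 = L\<close> gives
  translation by \<open>u\<close>. No representative has to be chosen.\<close>

definition torus_shift :: "'a::euclidean_space \<Rightarrow> 'a set \<Rightarrow> 'a set \<Rightarrow> 'a set" where
  "torus_shift u L C = {c + u + v | c v. c \<in> C \<and> v \<in> L}"

lemma torus_shift_tproj:
  assumes "add_subgroup L0" "add_subgroup L" "L0 \<subseteq> L"
  shows "torus_shift u L (tproj L0 x) = tproj L (x + u)"
proof (intro equalityI subsetI)
  fix y assume "y \<in> torus_shift u L (tproj L0 x)"
  then obtain w v where "w \<in> L" "v \<in> L" "y = x + w + u + v"
    using assms(3) unfolding torus_shift_def tproj_def by blast
  then show "y \<in> tproj L (x + u)"
    unfolding tproj_def using add_subgroup_add[OF assms(2), of w v]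
    by (auto simp: image_iff algebra_simps intro!: bexI[of _ "w + v"])
next
  fix y assume "y \<in> tproj L (x + u)"
  then obtain v where "v \<in> L" "y = x + u + v" unfolding tproj_def by blast
  then show "y \<in> torus_shift u L (tproj L0 x)"
    unfolding torus_shift_def tproj_def using add_subgroup_0[OF assms(1)] by force
qed

lemma continuous_map_torus_shift:
  assumes "add_subgroup L0" "add_subgroup L" "L0 \<subseteq> L"
  shows "continuous_map (torus L0) (torus L) (torus_shift u L)"
proof (rule continuous_compose_quotient_map[OF quotient_map_torus])
  have "torus_shift u L \<circ> tproj L0 = tproj L \<circ> (\<lambda>x. x + u)"
    using torus_shift_tproj[OF assms] by auto
  moreover have "continuous_map euclidean (torus L) (tproj L \<circ> (\<lambda>x. x + u))"
    by (rule continuous_map_compose[OF _ quotient_imp_continuous_map[OF quotient_map_torus]])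
      (auto intro!: continuous_intros)
  ultimately show "continuous_map euclidean (torus L) (torus_shift u L \<circ> tproj L0)" by simp
qed

text \<open>Likewise serves as the splintering map (for \<open>u = 0\<close>) and as a translation
  automorphism (from a tree to itself). Acting by images, it preserves the covering
  relation.\<close>

definition tree_shift :: "'a::euclidean_space \<Rightarrow> 'a set \<Rightarrow> 'a mtpoint \<Rightarrow> 'a mtpoint" where
  "tree_shift u L = (\<lambda>(\<Gamma>, s). (torus_shift u L ` \<Gamma>, s))"

lemma covers_tree_shift: "covers A B \<Longrightarrow> covers (tree_shift u L A) (tree_shift u L B)"
  by (auto simp: covers_def tree_shift_def split: prod.splits)

section \<open>Components of periodic sublevel sets\<close>

text \<open>Only the large lattice is fixed; sublattices are parameters of the lemmas, so that one
  filtration of R^d feeds all the trees being compared.\<close>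

locale periodic_filtration =
  fixes K :: "'a::euclidean_space set set" and F :: "'a set \<Rightarrow> real" and \<Lambda> :: "'a set"
  assumes complex: "cell_complex K"
    and periodic: "periodic_complex K \<Lambda>" "periodic_filter K F \<Lambda>"
    and subgroup: "add_subgroup \<Lambda>"
begin

lemma cell_connected_closed:
  assumes "\<sigma> \<in> K"
  shows "connected \<sigma>" "closed \<sigma>"
proof -
  obtain S :: "'a set" and f g where S: "subspace S" "homeomorphism (cball 0 1 \<inter> S) \<sigma> f g"
    using complex assms unfolding cell_complex_def by metis
  have eq: "\<sigma> = f ` (cball 0 1 \<inter> S)" and cont: "continuous_on (cball 0 1 \<inter> S) f"
    using S(2) unfolding homeomorphism_def by auto
  have "convex (cball 0 1 \<inter> S)" using S(1) by (simp add: convex_Int subspace_imp_convex)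
  then show "connected \<sigma>" unfolding eq by (intro connected_continuous_image cont convex_connected)
  have "compact (cball 0 1 \<inter> S)" using S(1) by (simp add: closed_subspace compact_Int_closed)
  then show "closed \<sigma>" unfolding eq by (intro compact_imp_closed compact_continuous_image cont)
qed

text \<open>Cells are compact, and a locally finite union of closed sets is closed.\<close>

lemma closed_Union_cells:
  assumes "\<U> \<subseteq> K"
  shows "closed (\<Union>\<U>)"
proof -
  have "locally_finite_in euclidean \<U>"
    unfolding locally_finite_in_def
  proof (intro conjI ballI)
    fix x :: 'a
    have "\<exists>e>0. finite {\<sigma>\<in>K. \<sigma> \<inter> ball x e \<noteq> {}}"
      using complex[unfolded cell_complex_def, THEN conjunct1] by (rule spec)
    then obtain e where e: "e > 0" "finite {\<sigma>\<in>K. \<sigma> \<inter> ball x e \<noteq> {}}" by blast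
    have "finite {\<sigma>\<in>\<U>. \<sigma> \<inter> ball x e \<noteq> {}}"
      using assms by (intro finite_subset[OF _ e(2)]) auto
    then show "\<exists>V. openin euclidean V \<and> x \<in> V \<and> finite {U \<in> \<U>. U \<inter> V \<noteq> {}}"
      using e(1) by (intro exI[of _ "ball x e"]) auto
  qed auto
  then have "closedin euclidean (\<Union>\<U>)"
    using cell_connected_closed(2) assms by (intro closedin_locally_finite_Union) auto
  then show ?thesis by simp
qed

lemma closed_sublevel: "closed (sublevel K F s)"
  unfolding sublevel_def by (rule closed_Union_cells) auto

lemma sublevel_mono: "s \<le> t \<Longrightarrow> sublevel K F s \<subseteq> sublevel K F t"
  unfolding sublevel_def by force

lemma cell_translate:
  assumes "\<sigma> \<in> K" "F \<sigma> \<le> s" "u \<in> \<Lambda>"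
  shows "(\<lambda>x. x + u) ` \<sigma> \<in> K" "F ((\<lambda>x. x + u) ` \<sigma>) \<le> s"
  using assms periodic unfolding periodic_complex_def periodic_filter_def by auto

lemma sublevel_translate:
  assumes "x \<in> sublevel K F s" "u \<in> \<Lambda>"
  shows "x + u \<in> sublevel K F s"
  using assms cell_translate unfolding sublevel_def by blast

lemma sublevel_translate_iff:
  assumes "u \<in> \<Lambda>"
  shows "x + u \<in> sublevel K F s \<longleftrightarrow> x \<in> sublevel K F s"
  using sublevel_translate[of "x + u" s "- u"] sublevel_translate[of x s u] assms
    add_subgroup_minus[OF subgroup] by auto

text \<open>A set that contains every cell it meets is a union of cells, and so is its complement in
  the sublevel set.\<close>

lemma union_of_cells_clopen:
  assumes "D \<subseteq> sublevel K F s" "\<And>\<sigma>. \<sigma> \<in> K \<Longrightarrow> F \<sigma> \<le> s \<Longrightarrow> \<sigma> \<inter> D \<noteq> {} \<Longrightarrow> \<sigma> \<subseteq> D"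
  shows "closed D" "closed (sublevel K F s - D)"
proof -
  have "D = \<Union>{\<sigma>\<in>K. F \<sigma> \<le> s \<and> \<sigma> \<subseteq> D}" using assms unfolding sublevel_def by blast
  then show "closed D" using closed_Union_cells[of "{\<sigma>\<in>K. F \<sigma> \<le> s \<and> \<sigma> \<subseteq> D}"] by auto
  have "sublevel K F s - D = \<Union>{\<sigma>\<in>K. F \<sigma> \<le> s \<and> \<sigma> \<inter> D = {}}"
    using assms unfolding sublevel_def by blast
  then show "closed (sublevel K F s - D)"
    using closed_Union_cells[of "{\<sigma>\<in>K. F \<sigma> \<le> s \<and> \<sigma> \<inter> D = {}}"] by auto
qed

text \<open>Components upstairs in R^d, indexed by a point; the value is empty when \<open>x\<close>
  lies outside the sublevel set.\<close>

definition cmp :: "real \<Rightarrow> 'a \<Rightarrow> 'a set" where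
  "cmp s x = connected_component_set (sublevel K F s) x"

lemma cmp_refl: "x \<in> sublevel K F s \<Longrightarrow> x \<in> cmp s x"
  by (simp add: cmp_def)

lemma cmp_eq: "y \<in> cmp s x \<Longrightarrow> cmp s y = cmp s x"
  unfolding cmp_def by (metis connected_component_eq)

lemma cmp_subset: "cmp s x \<subseteq> sublevel K F s"
  by (simp add: cmp_def connected_component_subset)

lemma connected_cmp: "connected (cmp s x)"
  by (simp add: cmp_def)

lemma cmp_maximal: "connected T \<Longrightarrow> T \<subseteq> sublevel K F s \<Longrightarrow> y \<in> T \<Longrightarrow> y \<in> cmp s x \<Longrightarrow> T \<subseteq> cmp s x"
  using cmp_eq connected_component_maximal unfolding cmp_def by metis

lemma cmp_translate_subset:
  assumes "u \<in> \<Lambda>"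
  shows "(\<lambda>y. y + u) ` cmp s x \<subseteq> cmp s (x + u)"
proof (cases "x \<in> sublevel K F s")
  case True
  show ?thesis
  proof (rule cmp_maximal)
    show "connected ((\<lambda>y. y + u) ` cmp s x)"
      by (intro connected_continuous_image connected_cmp continuous_intros)
    show "(\<lambda>y. y + u) ` cmp s x \<subseteq> sublevel K F s"
      using cmp_subset sublevel_translate assms by blast
    show "x + u \<in> (\<lambda>y. y + u) ` cmp s x" using cmp_refl[OF True] by blast
    show "x + u \<in> cmp s (x + u)" using cmp_refl sublevel_translate True assms by blast
  qed
next
  case False
  then have "cmp s x = {}" unfolding cmp_def by (simp only: connected_component_eq_empty not_False_eq_True)
  then show ?thesis by simp
qed

lemma cmp_translate:
  assumes "u \<in> \<Lambda>"
  shows "y + u \<in> cmp s (x + u) \<longleftrightarrow> y \<in> cmp s x"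
proof
  assume "y + u \<in> cmp s (x + u)"
  then have "(y + u) + (- u) \<in> cmp s ((x + u) + (- u))"
    using cmp_translate_subset[OF add_subgroup_minus[OF subgroup assms]] by blast
  then show "y \<in> cmp s x" by simp
qed (use cmp_translate_subset[OF assms] in blast)

lemma cmp_translate_image:
  assumes "u \<in> \<Lambda>"
  shows "cmp s (x + u) = (\<lambda>y. y + u) ` cmp s x"
proof
  show "cmp s (x + u) \<subseteq> (\<lambda>y. y + u) ` cmp s x"
  proof
    fix z assume "z \<in> cmp s (x + u)"
    then have "z - u \<in> cmp s x" using cmp_translate[OF assms, of "z - u"] by simp
    then show "z \<in> (\<lambda>y. y + u) ` cmp s x" by (intro image_eqI[of _ _ "z - u"]) auto
  qed
qed (rule cmp_translate_subset[OF assms])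

lemma cmp_eq_translate:
  assumes "u \<in> \<Lambda>" "y + u \<in> cmp s x"
  shows "cmp s y = cmp s (x - u)"
proof -
  have "(y + u) + (- u) \<in> cmp s (x + (- u))"
    using assms cmp_translate[OF add_subgroup_minus[OF subgroup assms(1)]] by blast
  then show ?thesis using cmp_eq by simp
qed

lemma tproj_mem_qsublevel:
  assumes "add_subgroup L" "L \<subseteq> \<Lambda>"
  shows "tproj L x \<in> qsublevel K F L s \<longleftrightarrow> x \<in> sublevel K F s"
  unfolding qsublevel_def tproj_mem_image_iff[OF assms(1)]
  using sublevel_translate_iff assms add_subgroup_0[OF assms(1)] by blast

text \<open>Quotient maps restrict to full preimages of closed sets. The sublevel set is such a
  preimage because it is invariant under \<open>L\<close>, and it is closed.\<close>

lemma quotient_map_qsublevel: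
  assumes "add_subgroup L" "L \<subseteq> \<Lambda>"
  shows "quotient_map (subtopology euclidean (sublevel K F s))
    (subtopology (torus L) (qsublevel K F L s)) (tproj L)"
proof (rule quotient_map_restriction[OF quotient_map_torus])
  show eq: "{x \<in> topspace euclidean. tproj L x \<in> qsublevel K F L s} = sublevel K F s"
    using tproj_mem_qsublevel[OF assms] by simp
  have "closedin (torus L) (qsublevel K F L s)"
  proof -
    have "closedin euclidean {x \<in> topspace euclidean. tproj L x \<in> qsublevel K F L s}"
      unfolding eq using closed_sublevel by simp
    moreover have "qsublevel K F L s \<subseteq> topspace (torus L)"
      by (auto simp: qsublevel_def topspace_torus)
    ultimately show ?thesis using quotient_map_torus[of L] unfolding quotient_map_closedin by blast
  qed
  then show "openin (torus L) (qsublevel K F L s) \<or> closedin (torus L) (qsublevel K F L s)" ..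
qed

text \<open>The image of a component is clopen: its preimage consists of the translates of the
  component, and a union of components of a locally finite union of connected cells is clopen.\<close>
lemma component_qsublevel:
  assumes L: "add_subgroup L" "L \<subseteq> \<Lambda>" and x: "x \<in> sublevel K F s"
  shows "connected_component_of_set (subtopology (torus L) (qsublevel K F L s)) (tproj L x)
    = tproj L ` cmp s x"
proof -
  let ?Y = "subtopology (torus L) (qsublevel K F L s)" and ?X = "subtopology euclidean (sublevel K F s)"
  let ?D = "{y \<in> sublevel K F s. tproj L y \<in> tproj L ` cmp s x}"
  note q = quotient_map_qsublevel[OF L, of s]
  have cont: "continuous_map ?X ?Y (tproj L)" using q by (rule quotient_imp_continuous_map)
  have conn: "connectedin ?Y (tproj L ` cmp s x)"
    by (rule connectedin_continuous_map_image[OF cont])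
      (use connected_cmp cmp_subset in \<open>auto simp: connectedin_subtopology\<close>)
  have sub: "tproj L ` cmp s x \<subseteq> topspace ?Y" using conn connectedin_subset_topspace by blast
  have "\<sigma> \<subseteq> ?D" if \<sigma>: "\<sigma> \<in> K" "F \<sigma> \<le> s" "\<sigma> \<inter> ?D \<noteq> {}" for \<sigma>
  proof -
    obtain y where y: "y \<in> \<sigma>" "y \<in> ?D" using \<sigma>(3) by blast
    then obtain u where u: "u \<in> L" "y + u \<in> cmp s x"
      by (auto simp: tproj_mem_image_iff[OF L(1)])
    have "u \<in> \<Lambda>" using u(1) L(2) by blast
    note tr = cell_translate[OF \<sigma>(1,2) this]
    \<comment> \<open>The translated cell is a connected part of the sublevel set that meets the
      component at \<open>y + u\<close>, so it cannot leave it.\<close>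
    have "(\<lambda>z. z + u) ` \<sigma> \<subseteq> cmp s x"
    proof (rule cmp_maximal[OF _ _ _ u(2)])
      show "connected ((\<lambda>z. z + u) ` \<sigma>)" using cell_connected_closed(1) tr(1) .
      show "(\<lambda>z. z + u) ` \<sigma> \<subseteq> sublevel K F s" unfolding sublevel_def using tr by blast
      show "y + u \<in> (\<lambda>z. z + u) ` \<sigma>" using y(1) by blast
    qed
    then show "\<sigma> \<subseteq> ?D"
      using u(1) \<sigma>(1,2) unfolding tproj_mem_image_iff[OF L(1)] sublevel_def by blast
  qed
  then have clo: "closed ?D" "closed (sublevel K F s - ?D)"
    using union_of_cells_clopen[of ?D s] by blast+
  have "closedin ?X ?D" using clo(1) by (intro closed_subset) auto
  moreover have "openin ?X ?D"
  proof -
    have "closedin ?X (sublevel K F s - ?D)" using clo(2) by (intro closed_subset) auto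
    then show ?thesis by (simp add: openin_closedin_eq)
  qed
  moreover have D: "?D = {y \<in> topspace ?X. tproj L y \<in> tproj L ` cmp s x}" by simp
  ultimately have "closedin ?Y (tproj L ` cmp s x)" "openin ?Y (tproj L ` cmp s x)"
    using q[unfolded quotient_map_closedin, THEN conjunct2, rule_format, OF sub]
      q[unfolded quotient_map_def, THEN conjunct2, rule_format, OF sub] unfolding D by simp_all
  note cases = connectedin_clopen_cases[OF _ this]
  have p: "tproj L x \<in> tproj L ` cmp s x" using cmp_refl[OF x] by blast
  show ?thesis
  proof
    show "connected_component_of_set ?Y (tproj L x) \<subseteq> tproj L ` cmp s x"
    proof
      fix c assume "c \<in> connected_component_of_set ?Y (tproj L x)"
      then obtain T where "connectedin ?Y T" "tproj L x \<in> T" "c \<in> T"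
        unfolding connected_component_of_def by blast
      then show "c \<in> tproj L ` cmp s x" using cases[of T] p by (auto simp: disjnt_iff)
    qed
    show "tproj L ` cmp s x \<subseteq> connected_component_of_set ?Y (tproj L x)"
      using connected_component_of_maximal[OF conn p] .
  qed
qed

section \<open>Points and maps of periodic merge trees\<close>

text \<open>Points of every tree are named by points of R^d. In these names the splintering map is
  simply \<open>tree_pt L0 s x\<close> to \<open>tree_pt L s x\<close>.\<close>

definition tree_pt :: "'a set \<Rightarrow> real \<Rightarrow> 'a \<Rightarrow> 'a mtpoint" where
  "tree_pt L s x = (tproj L ` cmp s x, s)"

lemma mt_class_tproj:
  assumes "add_subgroup L" "L \<subseteq> \<Lambda>" "x \<in> sublevel K F s"
  shows "mt_class K F L (tproj L x, s) = tree_pt L s x"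
  using component_qsublevel[OF assms] by (simp add: mt_class_def tree_pt_def)

lemma topspace_sublevel_pairs:
  "topspace (subtopology (prod_topology (torus L) euclideanreal) {(p, s). p \<in> qsublevel K F L s})
    = {(tproj L x, s) | x s. x \<in> sublevel K F s}"
  by (auto simp: topspace_torus qsublevel_def)

lemma topspace_mt_top:
  assumes "add_subgroup L" "L \<subseteq> \<Lambda>"
  shows "topspace (mt_top K F L) = {tree_pt L s x | s x. x \<in> sublevel K F s}"
proof -
  have "topspace (mt_top K F L) = mt_class K F L ` {(tproj L x, s) | x s. x \<in> sublevel K F s}"
    unfolding mt_top_def topspace_quotient_topology topspace_sublevel_pairs ..
  also have "{(tproj L x, s) | x s. x \<in> sublevel K F s}
      = (\<lambda>(x, s). (tproj L x, s)) ` {(x, s). x \<in> sublevel K F s}" by auto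
  also have "mt_class K F L ` \<dots> = (\<lambda>(x, s). mt_class K F L (tproj L x, s)) ` {(x, s). x \<in> sublevel K F s}"
    by (simp add: image_image case_prod_unfold)
  also have "\<dots> = (\<lambda>(x, s). tree_pt L s x) ` {(x, s). x \<in> sublevel K F s}"
    by (rule image_cong) (auto simp: mt_class_tproj[OF assms])
  also have "\<dots> = {tree_pt L s x | s x. x \<in> sublevel K F s}" by force
  finally show ?thesis .
qed

lemma tree_shift_tree_pt:
  assumes "add_subgroup L0" "add_subgroup L" "L0 \<subseteq> L" "u \<in> \<Lambda>"
  shows "tree_shift u L (tree_pt L0 s x) = tree_pt L s (x + u)"
  by (simp add: tree_shift_def tree_pt_def cmp_translate_image[OF assms(4)] image_image
      torus_shift_tproj[OF assms(1-3)])

text \<open>The shift acts continuously on pairs of a torus point and a height and commutes with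
  passing to components, so it descends to the quotients.\<close>

lemma continuous_map_tree_shift:
  assumes L: "add_subgroup L0" "add_subgroup L" "L0 \<subseteq> L" "L \<subseteq> \<Lambda>" and u: "u \<in> \<Lambda>"
  shows "continuous_map (mt_top K F L0) (mt_top K F L) (tree_shift u L)"
proof -
  let ?Z = "\<lambda>L. subtopology (prod_topology (torus L) euclideanreal) {(p, s). p \<in> qsublevel K F L s}"
  let ?h = "\<lambda>(p, s). (torus_shift u L p, s)"
  have q: "quotient_map (?Z L') (mt_top K F L') (mt_class K F L')" for L'
    unfolding mt_top_def by (rule quotient_map_quotient_topology)
  have "continuous_map (prod_topology (torus L0) euclideanreal) (prod_topology (torus L) euclideanreal) ?h"
    unfolding continuous_map_prod_top
    using continuous_map_torus_shift[OF L(1-3)] by simp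
  moreover have "?h ` topspace (?Z L0) \<subseteq> {(p, s). p \<in> qsublevel K F L s}"
    unfolding topspace_sublevel_pairs
    using torus_shift_tproj[OF L(1-3)] sublevel_translate u by (auto simp: qsublevel_def)
  ultimately have "continuous_map (?Z L0) (?Z L) ?h"
    by (intro continuous_map_into_subtopology continuous_map_from_subtopology) auto
  then have "continuous_map (?Z L0) (mt_top K F L) (mt_class K F L \<circ> ?h)"
    using quotient_imp_continuous_map[OF q] by (rule continuous_map_compose)
  moreover have "(mt_class K F L \<circ> ?h) z = (tree_shift u L \<circ> mt_class K F L0) z"
    if z: "z \<in> topspace (?Z L0)" for z
  proof -
    obtain x s where "z = (tproj L0 x, s)" "x \<in> sublevel K F s"
      using z unfolding topspace_sublevel_pairs by blast
    then show ?thesis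
      using mt_class_tproj[of L0 x s] mt_class_tproj[of L "x + u" s] L u sublevel_translate
      by (simp add: torus_shift_tproj[OF L(1-3)] tree_shift_tree_pt[OF L(1-3) u])
  qed
  ultimately have "continuous_map (?Z L0) (mt_top K F L) (tree_shift u L \<circ> mt_class K F L0)"
    by (rule continuous_map_eq)
  then show ?thesis by (rule continuous_compose_quotient_map[OF q])
qed

text \<open>Two components upstairs have the same image exactly when they are
  \<open>L\<close>-translates of each other.\<close>

lemma tree_pt_eq_iff:
  assumes L: "add_subgroup L" "L \<subseteq> \<Lambda>" and y: "y \<in> sublevel K F s"
  shows "tree_pt L s x = tree_pt L s y \<longleftrightarrow> (\<exists>u\<in>L. y + u \<in> cmp s x)"
proof
  assume "tree_pt L s x = tree_pt L s y"
  then have "tproj L y \<in> tproj L ` cmp s x" using cmp_refl[OF y] by (simp add: tree_pt_def)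
  then show "\<exists>u\<in>L. y + u \<in> cmp s x" by (simp add: tproj_mem_image_iff[OF L(1)])
next
  assume "\<exists>u\<in>L. y + u \<in> cmp s x"
  then obtain u where u: "u \<in> L" "y + u \<in> cmp s x" by blast
  have "u \<in> \<Lambda>" using u L by blast
  then have "cmp s x = (\<lambda>z. z + u) ` cmp s y" using cmp_eq[OF u(2)] cmp_translate_image by metis
  moreover have "tproj L (z + u) = tproj L z" for z using u(1) by (simp add: tproj_eq_iff[OF L(1)])
  ultimately show "tree_pt L s x = tree_pt L s y" by (simp add: tree_pt_def image_image)
qed

section \<open>Stabilizers and period lattices\<close>

text \<open>Taken in the whole of \<open>\<Lambda>\<close>, so that intersecting with
  \<open>L\<close> or \<open>L0\<close> yields both period lattices. Testing the single point
  \<open>x\<close> suffices, since distinct components are disjoint.\<close>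

definition stabilizer :: "real \<Rightarrow> 'a \<Rightarrow> 'a set" where
  "stabilizer s x = {u \<in> \<Lambda>. x + u \<in> cmp s x}"

lemma stabilizer_eq:
  assumes "x \<in> sublevel K F s"
  shows "stabilizer s x = {u \<in> \<Lambda>. (\<lambda>y. y + u) ` cmp s x = cmp s x}"
proof -
  have "x + u \<in> cmp s x \<longleftrightarrow> (\<lambda>y. y + u) ` cmp s x = cmp s x" if u: "u \<in> \<Lambda>" for u
  proof
    assume "x + u \<in> cmp s x"
    then show "(\<lambda>y. y + u) ` cmp s x = cmp s x" using cmp_eq cmp_translate_image[OF u] by metis
  next
    assume "(\<lambda>y. y + u) ` cmp s x = cmp s x"
    then show "x + u \<in> cmp s x" using cmp_refl[OF assms] by blast
  qed
  then show ?thesis unfolding stabilizer_def by blast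
qed

text \<open>Stabilizers along an orbit are conjugate, and the group is abelian. This makes period
  lattices independent of the chosen shadow.\<close>

lemma stabilizer_translate:
  assumes "v \<in> \<Lambda>"
  shows "stabilizer s (x + v) = stabilizer s x"
proof -
  have "x + v + u \<in> cmp s (x + v) \<longleftrightarrow> x + u \<in> cmp s x" for u
    using cmp_translate[OF assms, of "x + u" s x] by (simp add: algebra_simps)
  then show ?thesis by (simp add: stabilizer_def)
qed

lemma add_subgroup_stabilizer:
  assumes "x \<in> sublevel K F s"
  shows "add_subgroup (stabilizer s x)"
  unfolding add_subgroup_def
proof (intro conjI ballI)
  show "0 \<in> stabilizer s x"
    using add_subgroup_0[OF subgroup] cmp_refl[OF assms] by (simp add: stabilizer_def)
  fix u v assume "u \<in> stabilizer s x" "v \<in> stabilizer s x"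
  then have u: "u \<in> \<Lambda>" "x + u \<in> cmp s x" and v: "v \<in> \<Lambda>" "x + v \<in> cmp s x"
    by (auto simp: stabilizer_def)
  have "(x + u) + (- v) \<in> cmp s (x + (- v))"
    using cmp_translate[OF add_subgroup_minus[OF subgroup v(1)]] u(2) by blast
  then have "x + (u - v) \<in> cmp s (x - v)" by (simp add: algebra_simps)
  also have "cmp s (x - v) = cmp s x" using cmp_eq_translate[OF v] by simp
  finally show "u - v \<in> stabilizer s x"
    using add_subgroup_diff[OF subgroup u(1) v(1)] by (simp add: stabilizer_def)
qed

text \<open>The preimage is the union of the translates by \<open>L\<close>; each is connected and
  already maximal in the larger sublevel set.\<close>

lemma components_preimage:
  assumes L: "add_subgroup L" "L \<subseteq> \<Lambda>" and x: "x \<in> sublevel K F s"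
  shows "components {y. tproj L y \<in> tproj L ` cmp s x} = (\<lambda>u. cmp s (x + u)) ` L"
proof -
  let ?D = "{y. tproj L y \<in> tproj L ` cmp s x}"
  have D: "?D = (\<Union>u\<in>L. cmp s (x + u))"
  proof (intro equalityI subsetI)
    fix y assume "y \<in> ?D"
    then obtain u where u: "u \<in> L" "y + u \<in> cmp s x" by (auto simp: tproj_mem_image_iff[OF L(1)])
    then have mu: "- u \<in> L" "- u \<in> \<Lambda>" using add_subgroup_minus[OF L(1)] L(2) by auto
    then have "y \<in> cmp s (x + (- u))" using cmp_translate[OF mu(2), of "y + u" s x] u(2) by simp
    then show "y \<in> (\<Union>u\<in>L. cmp s (x + u))" using mu(1) by blast
  next
    fix y assume "y \<in> (\<Union>u\<in>L. cmp s (x + u))"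
    then obtain u where u: "u \<in> L" "y \<in> cmp s (x + u)" by blast
    then have mu: "- u \<in> L" "- u \<in> \<Lambda>" using add_subgroup_minus[OF L(1)] L(2) by auto
    then have "y + (- u) \<in> cmp s x" using cmp_translate[OF mu(2), of y s "x + u"] u(2) by simp
    then show "y \<in> ?D" using mu(1) tproj_mem_image_iff[OF L(1)] by blast
  qed
  have DS: "?D \<subseteq> sublevel K F s" unfolding D using cmp_subset by blast
  have comp: "connected_component_set ?D y = cmp s (x + u)" if u: "u \<in> L" and y: "y \<in> cmp s (x + u)" for u y
  proof
    show "connected_component_set ?D y \<subseteq> cmp s (x + u)"
      using connected_component_mono[OF DS] cmp_eq[OF y] unfolding cmp_def by blast
    show "cmp s (x + u) \<subseteq> connected_component_set ?D y"
      using u y D by (intro connected_component_maximal connected_cmp) auto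
  qed
  show ?thesis
  proof (intro equalityI subsetI)
    fix \<gamma> assume "\<gamma> \<in> components ?D"
    then obtain y where y: "y \<in> ?D" "\<gamma> = connected_component_set ?D y" by (auto simp: components_def)
    then obtain u where "u \<in> L" "y \<in> cmp s (x + u)" unfolding D by blast
    then show "\<gamma> \<in> (\<lambda>u. cmp s (x + u)) ` L" using comp y(2) by blast
  next
    fix \<gamma> assume "\<gamma> \<in> (\<lambda>u. cmp s (x + u)) ` L"
    then obtain u where u: "u \<in> L" "\<gamma> = cmp s (x + u)" by blast
    then have "x + u \<in> cmp s (x + u)" using L(2) x sublevel_translate cmp_refl by blast
    then have "x + u \<in> ?D" "\<gamma> = connected_component_set ?D (x + u)" using u comp D by auto
    then show "\<gamma> \<in> components ?D" unfolding components_def by blast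
  qed
qed

text \<open>The shadow picked by the choice operator is some translate of \<open>cmp s x\<close>,
  and translates share their stabilizer.\<close>

lemma period_lattice_eq:
  assumes L: "add_subgroup L" "L \<subseteq> \<Lambda>" and x: "x \<in> sublevel K F s"
  shows "period_lattice L (tproj L ` cmp s x) = stabilizer s x \<inter> L"
proof -
  have "components {y. tproj L y \<in> tproj L ` cmp s x} \<noteq> {}"
    unfolding components_preimage[OF assms] using add_subgroup_0[OF L(1)] by blast
  then have "shadow L (tproj L ` cmp s x) \<in> (\<lambda>u. cmp s (x + u)) ` L"
    unfolding shadow_def components_preimage[OF assms] by (simp add: some_in_eq)
  then obtain u where u: "u \<in> L" "shadow L (tproj L ` cmp s x) = cmp s (x + u)" by blast
  have u': "u \<in> \<Lambda>" using u L by blast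
  have "period_lattice L (tproj L ` cmp s x) = stabilizer s (x + u) \<inter> L"
    unfolding period_lattice_def u(2) stabilizer_eq[OF sublevel_translate[OF x u']] using L(2) by blast
  then show ?thesis by (simp add: stabilizer_translate[OF u'])
qed

lemma shadow_monomial_translate:
  assumes L: "add_subgroup L" "L \<subseteq> \<Lambda>" and "x \<in> sublevel K F s" "u \<in> \<Lambda>"
  shows "shadow_monomial L (tproj L ` cmp s (x + u)) = shadow_monomial L (tproj L ` cmp s x)"
  unfolding shadow_monomial_def
  by (simp add: period_lattice_eq[OF L] assms sublevel_translate stabilizer_translate)

lemma snd_tree_pt: "snd (tree_pt L s x) = s"
  by (simp add: tree_pt_def)

lemma tree_shift_subtree:
  assumes L: "add_subgroup L" "L \<subseteq> \<Lambda>" and u: "u \<in> \<Lambda>"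
  defines "M \<equiv> merge_tree K F L"
  shows "continuous_map (ptop (subtree M (tree_pt L s x))) (ptop (subtree M (tree_pt L s (x + u))))
      (tree_shift u L)"
    and "\<And>A. A \<in> topspace (ptop (subtree M (tree_pt L s x))) \<Longrightarrow>
      pht M (tree_shift u L A) = pht M A \<and> tree_shift (- u) L (tree_shift u L A) = A \<and>
      pfreq M (tree_shift u L A) = pfreq M A"
proof -
  note ts = tree_shift_tree_pt[OF L(1) L(1) subset_refl]
  have M: "ptop M = mt_top K F L" by (simp add: M_def merge_tree_def)
  have cont: "continuous_map (ptop M) (ptop M) (tree_shift u L)"
    unfolding M using L u by (intro continuous_map_tree_shift) auto
  have "tree_shift u L A \<in> {B \<in> topspace (ptop M). covers B (tree_pt L s (x + u))}"
    if "A \<in> topspace (ptop M)" "covers A (tree_pt L s x)" for A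
    using that covers_tree_shift[OF that(2), of u L] ts[OF u]
      continuous_map_image_subset_topspace[OF cont] by auto
  then show "continuous_map (ptop (subtree M (tree_pt L s x))) (ptop (subtree M (tree_pt L s (x + u))))
      (tree_shift u L)"
    unfolding subtree_def pmt.select_convs
    by (intro continuous_map_into_subtopology[OF continuous_map_from_subtopology[OF cont]]) fastforce
  fix A assume "A \<in> topspace (ptop (subtree M (tree_pt L s x)))"
  then have "A \<in> topspace (mt_top K F L)" by (simp add: subtree_def M)
  then obtain t z where A: "A = tree_pt L t z" "z \<in> sublevel K F t"
    unfolding topspace_mt_top[OF L] by blast
  show "pht M (tree_shift u L A) = pht M A \<and> tree_shift (- u) L (tree_shift u L A) = A \<and>
      pfreq M (tree_shift u L A) = pfreq M A"
    unfolding A(1) ts[OF u] ts[OF add_subgroup_minus[OF subgroup u]]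
    using shadow_monomial_translate[OF L A(2) u]
    by (simp add: M_def merge_tree_def tree_pt_def)
qed

text \<open>The shifts by \<open>u\<close> and \<open>- u\<close> are mutually inverse and preserve
  height and frequency, so they are compatible for \<open>\<epsilon> = 0\<close>.\<close>

lemma dI_subtree_translate:
  assumes L: "add_subgroup L" "L \<subseteq> \<Lambda>" and u: "u \<in> \<Lambda>"
  shows "dI (subtree (merge_tree K F L) (tree_pt L s x))
    (subtree (merge_tree K F L) (tree_pt L s (x + u))) = 0"
proof (rule dI_eq_0I)
  let ?M = "merge_tree K F L"
  have mu: "- u \<in> \<Lambda>" by (rule add_subgroup_minus[OF subgroup u])
  note fwd = tree_shift_subtree[OF L u, where s = s and x = x]
    and bwd = tree_shift_subtree[OF L mu, where s = s and x = "x + u"]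
  have eq: "x + u + - u = x" "- (- u) = u" by auto
  show "compatible 0 (subtree ?M (tree_pt L s x)) (subtree ?M (tree_pt L s (x + u)))
      (tree_shift u L) (tree_shift (- u) L)"
    unfolding compatible_def
    using fwd bwd[unfolded eq] by (auto simp: subtree_def covers_def mono_le_refl)
qed

section \<open>Fibres, frequencies and the splintering map\<close>

lemma tree_fibre:
  assumes L: "add_subgroup L0" "add_subgroup L" "L0 \<subseteq> L" "L \<subseteq> \<Lambda>" and x: "x \<in> sublevel K F s"
  shows "{z \<in> topspace (mt_top K F L0). tree_shift 0 L z = tree_pt L s x}
    = (\<lambda>v. tree_pt L0 s (x + v)) ` L"
proof -
  have L0: "L0 \<subseteq> \<Lambda>" using L by blast
  note ts = tree_shift_tree_pt[OF L(1-3) add_subgroup_0[OF subgroup], simplified]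
  show ?thesis
  proof (intro equalityI subsetI)
    fix A assume "A \<in> {z \<in> topspace (mt_top K F L0). tree_shift 0 L z = tree_pt L s x}"
    then obtain t z where A: "A = tree_pt L0 t z" "z \<in> sublevel K F t" "tree_pt L t z = tree_pt L s x"
      unfolding topspace_mt_top[OF L(1) L0] by (auto simp: ts)
    have t: "t = s" using A(3) by (simp add: tree_pt_def)
    then obtain u where u: "u \<in> L" "z + u \<in> cmp s x"
      using A(2,3) tree_pt_eq_iff[OF L(2,4), of z s x] by auto
    then have "cmp s z = cmp s (x + (- u))" using cmp_eq_translate[of u z s x] L(4) by auto
    then have "A = tree_pt L0 s (x + (- u))" using A(1) t by (simp add: tree_pt_def)
    then show "A \<in> (\<lambda>v. tree_pt L0 s (x + v)) ` L" using add_subgroup_minus[OF L(2) u(1)] by blast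
  next
    fix A assume "A \<in> (\<lambda>v. tree_pt L0 s (x + v)) ` L"
    then obtain v where v: "v \<in> L" "A = tree_pt L0 s (x + v)" by blast
    then have xv: "x + v \<in> sublevel K F s" using x L(4) sublevel_translate by blast
    have "x + v + (- v) \<in> cmp s x" using cmp_refl[OF x] by simp
    then have "tree_pt L s x = tree_pt L s (x + v)"
      using tree_pt_eq_iff[OF L(2,4) xv] add_subgroup_minus[OF L(2) v(1)] by blast
    then show "A \<in> {z \<in> topspace (mt_top K F L0). tree_shift 0 L z = tree_pt L s x}"
      unfolding topspace_mt_top[OF L(1) L0] using v(2) xv by (auto simp: ts)
  qed
qed

text \<open>Translates of \<open>x\<close> by \<open>v\<close> and \<open>v'\<close> give the same
  point downstairs exactly when \<open>v' - v\<close> is a sum of a period and an element of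
  \<open>L0\<close>.\<close>

lemma card_tree_fibre:
  assumes L: "add_subgroup L0" "add_subgroup L" "L0 \<subseteq> L" "L \<subseteq> \<Lambda>" and x: "x \<in> sublevel K F s"
  shows "card {z \<in> topspace (mt_top K F L0). tree_shift 0 L z = tree_pt L s x}
    = card (tproj (set_sum (stabilizer s x \<inter> L) L0) ` L)"
  unfolding tree_fibre[OF assms]
proof (rule card_image_eq_of_kernel_eq)
  let ?P = "stabilizer s x \<inter> L"
  have L0: "L0 \<subseteq> \<Lambda>" using L by blast
  have S: "add_subgroup (set_sum ?P L0)"
    using add_subgroup_set_sum add_subgroup_Int add_subgroup_stabilizer[OF x] L by blast
  fix v v' assume v: "v \<in> L" "v' \<in> L"
  then have v\<Lambda>: "v \<in> \<Lambda>" "v' \<in> \<Lambda>" using L(4) by auto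
  have "tree_pt L0 s (x + v) = tree_pt L0 s (x + v') \<longleftrightarrow> (\<exists>w\<in>L0. x + v' + w \<in> cmp s (x + v))"
    using tree_pt_eq_iff[OF L(1) L0] sublevel_translate[OF x v\<Lambda>(2)] by blast
  also have "\<dots> \<longleftrightarrow> (\<exists>w\<in>L0. v' + w - v \<in> ?P)"
  proof (rule bex_cong[OF refl])
    fix w assume w: "w \<in> L0"
    have "v' + w - v \<in> L" using v w L(2,3) by (meson add_subgroup_add add_subgroup_diff subsetD)
    moreover have "x + v' + w \<in> cmp s (x + v) \<longleftrightarrow> x + (v' + w - v) \<in> cmp s x"
      using cmp_translate[OF v\<Lambda>(1), of "x + (v' + w - v)" s x] by (simp add: algebra_simps)
    ultimately show "x + v' + w \<in> cmp s (x + v) \<longleftrightarrow> v' + w - v \<in> ?P"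
      using L(4) by (auto simp: stabilizer_def)
  qed
  also have "\<dots> \<longleftrightarrow> v' - v \<in> set_sum ?P L0"
  proof
    assume "\<exists>w\<in>L0. v' + w - v \<in> ?P"
    then obtain w where w: "w \<in> L0" "v' + w - v \<in> ?P" by blast
    have "(v' + w - v) + (- w) \<in> set_sum ?P L0"
      using w(2) add_subgroup_minus[OF L(1) w(1)] unfolding set_sum_def by blast
    then show "v' - v \<in> set_sum ?P L0" by simp
  next
    assume "v' - v \<in> set_sum ?P L0"
    then obtain p w where p: "p \<in> ?P" "w \<in> L0" "v' - v = p + w" unfolding set_sum_def by blast
    have "v' + (- w) - v = p" using p(3) by (simp add: algebra_simps)
    then show "\<exists>w\<in>L0. v' + w - v \<in> ?P" using p(1) add_subgroup_minus[OF L(1) p(2)] by metis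
  qed
  also have "\<dots> \<longleftrightarrow> tproj (set_sum ?P L0) v = tproj (set_sum ?P L0) v'"
    using tproj_eq_iff[OF S, of v' v] by auto
  finally show "tree_pt L0 s (x + v) = tree_pt L0 s (x + v') \<longleftrightarrow>
      tproj (set_sum ?P L0) v = tproj (set_sum ?P L0) v'" .
qed

lemma shadow_monomial_sublattice:
  assumes L: "is_lattice L0 DIM('a)" "is_lattice L DIM('a)" "L0 \<subseteq> L" "L \<subseteq> \<Lambda>"
    and x: "x \<in> sublevel K F s"
  defines "m \<equiv> shadow_monomial L (tproj L ` cmp s x)"
    and "n \<equiv> card (tproj (set_sum (stabilizer s x \<inter> L) L0) ` L)"
  shows "shadow_monomial L0 (tproj L0 ` cmp s x) = (fst m / real n, snd m)"
proof -
  define P where "P = stabilizer s x \<inter> L"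
  define k where "k = card (tproj (P \<inter> L0) ` P)"
  have g: "add_subgroup L0" "add_subgroup L" using L is_lattice_add_subgroup by auto
  have L0: "L0 \<subseteq> \<Lambda>" using L by blast
  have P: "add_subgroup P" "P \<subseteq> L"
    unfolding P_def using add_subgroup_Int add_subgroup_stabilizer[OF x] g by auto
  have PL0: "add_subgroup (P \<inter> L0)" "P \<inter> L0 \<subseteq> P" using add_subgroup_Int P(1) g(1) by auto
  have per: "period_lattice L (tproj L ` cmp s x) = P"
    "period_lattice L0 (tproj L0 ` cmp s x) = P \<inter> L0"
    using period_lattice_eq[OF g(2) L(4) x] period_lattice_eq[OF g(1) L0 x] L(3)
    unfolding P_def by auto
  note ix = sublattice_index[OF L(2) g(1) L(3) lattice_dim_eq(2)[OF L(1)]]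
  note im = index_mult[OF g(2) g(1) L(3) P]
  have fin: "finite (tproj (P \<inter> L0) ` P)" using im(2) ix(1) by blast
  have "P \<noteq> {}" using add_subgroup_0[OF P(1)] by blast
  \<comment> \<open>Finiteness excludes the default value 0 of \<open>card\<close>, so
    \<open>k\<close> may be cancelled in the quotient of volumes.\<close>
  then have k0: "k \<noteq> 0" unfolding k_def using fin by simp
  have latP: "is_lattice P (dim P)" using subgroup_is_lattice[OF L(2) P] .
  have dim: "dim (P \<inter> L0) = dim P" by (rule finite_index_dim[OF P(1) PL0 fin])
  have latPL0: "is_lattice (P \<inter> L0) (dim P)" using subgroup_is_lattice[OF latP PL0] dim by simp
  have ldim: "lattice_dim (P \<inter> L0) = lattice_dim P"
    using lattice_dim_eq(1)[OF latP] lattice_dim_eq(1)[OF latPL0] by simp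
  have vol: "lattice_vol (P \<inter> L0) = real k * lattice_vol P"
    unfolding k_def by (rule sublattice_index(2)[OF latP PL0 dim])
  have volL: "lattice_vol L0 = real n * real k * lattice_vol L"
    using ix(2) im(1) unfolding n_def k_def P_def by simp
  have "lattice_vol (P \<inter> L0) / lattice_vol L0 = lattice_vol P / lattice_vol L / real n"
    unfolding vol volL using k0 by (simp add: field_simps)
  then show ?thesis
    unfolding m_def shadow_monomial_def Let_def per ldim by simp
qed

text \<open>Surjectivity is a lifting statement: a component below the image need not lift below
  \<open>cmp s x\<close> through its given representative, but some \<open>L\<close>-translate
  does.\<close>

lemma tree_shift_subtree_onto:
  assumes L: "add_subgroup L0" "add_subgroup L" "L0 \<subseteq> L" "L \<subseteq> \<Lambda>" and x: "x \<in> sublevel K F s"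
  shows "tree_shift 0 L ` topspace (ptop (subtree (merge_tree K F L0) (tree_pt L0 s x)))
    = topspace (ptop (subtree (merge_tree K F L) (tree_pt L s x)))"
proof -
  have L0: "L0 \<subseteq> \<Lambda>" using L by blast
  note ts = tree_shift_tree_pt[OF L(1-3) add_subgroup_0[OF subgroup], simplified]
  note ts' = topspace_mt_top[OF L(1) L0] topspace_mt_top[OF L(2,4)]
  have top: "topspace (ptop (subtree (merge_tree K F L') \<Gamma>)) = {A \<in> topspace (mt_top K F L'). covers A \<Gamma>}"
    for L' \<Gamma> by (auto simp: subtree_def merge_tree_def)
  show ?thesis unfolding top
  proof (intro equalityI subsetI)
    fix B assume "B \<in> tree_shift 0 L ` {A \<in> topspace (mt_top K F L0). covers A (tree_pt L0 s x)}"
    then obtain A where A: "A \<in> topspace (mt_top K F L0)" "covers A (tree_pt L0 s x)" "B = tree_shift 0 L A"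
      by blast
    then obtain t z where "A = tree_pt L0 t z" "z \<in> sublevel K F t" unfolding ts' by blast
    then show "B \<in> {A \<in> topspace (mt_top K F L). covers A (tree_pt L s x)}"
      unfolding ts' using A(3) covers_tree_shift[OF A(2), of 0 L] by (auto simp: ts)
  next
    fix B assume "B \<in> {A \<in> topspace (mt_top K F L). covers A (tree_pt L s x)}"
    then obtain t z where B: "B = tree_pt L t z" "z \<in> sublevel K F t" and cov: "covers B (tree_pt L s x)"
      unfolding ts' by blast
    have t: "t \<le> s" and sub: "tproj L ` cmp t z \<subseteq> tproj L ` cmp s x"
      using cov B(1) by (auto simp: covers_def tree_pt_def)
    then have "tproj L z \<in> tproj L ` cmp s x" using cmp_refl[OF B(2)] by blast
    \<comment> \<open>Corrects the representative \<open>z\<close> by a lattice vector; the lower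
      component through \<open>z + u\<close> then lies in \<open>cmp s x\<close> by
      connectedness.\<close>
    then obtain u where u: "u \<in> L" "z + u \<in> cmp s x" by (auto simp: tproj_mem_image_iff[OF L(2)])
    have zu: "z + u \<in> sublevel K F t" using u(1) L(4) B(2) sublevel_translate by blast
    have "cmp t (z + u) \<subseteq> cmp s x"
      by (rule cmp_maximal[OF connected_cmp _ cmp_refl[OF zu] u(2)])
        (use cmp_subset sublevel_mono[OF t] in blast)
    then have "covers (tree_pt L0 t (z + u)) (tree_pt L0 s x)"
      using t by (auto simp: covers_def tree_pt_def)
    moreover have "tree_pt L0 t (z + u) \<in> topspace (mt_top K F L0)" unfolding ts' using zu by blast
    moreover have "B = tree_shift 0 L (tree_pt L0 t (z + u))"
    proof -
      have "z + u + (- u) \<in> cmp t z" using cmp_refl[OF B(2)] by simp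
      then have "tree_pt L t z = tree_pt L t (z + u)"
        using tree_pt_eq_iff[OF L(2,4) zu] add_subgroup_minus[OF L(2) u(1)] by blast
      then show ?thesis using B(1) by (simp add: ts)
    qed
    ultimately show "B \<in> tree_shift 0 L ` {A \<in> topspace (mt_top K F L0). covers A (tree_pt L0 s x)}"
      by blast
  qed
qed

lemma splinters_sublattice:
  assumes L: "is_lattice L0 DIM('a)" "is_lattice L DIM('a)" "L0 \<subseteq> L" "L \<subseteq> \<Lambda>"
  shows "splinters (merge_tree K F L0) (merge_tree K F L)"
proof -
  have g: "add_subgroup L0" "add_subgroup L" using L is_lattice_add_subgroup by auto
  have L0: "L0 \<subseteq> \<Lambda>" using L by blast
  let ?N = "merge_tree K F L0" and ?M = "merge_tree K F L"
  have top: "ptop (merge_tree K F L') = mt_top K F L'" "pht (merge_tree K F L') = snd" for L'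
    by (simp_all add: merge_tree_def)
  note ts = tree_shift_tree_pt[OF g L(3) add_subgroup_0[OF subgroup], simplified]
  have freq: "pfreq (merge_tree K F L') (tree_pt L' s x) = shadow_monomial L' (tproj L' ` cmp s x)"
    for L' s x by (simp add: merge_tree_def tree_pt_def)
  \<comment> \<open>A single point of R^d names both a tree point and its image.\<close>
  have fib: "\<exists>x\<in>sublevel K F s. A = tree_pt L0 s x \<and> \<Gamma> = tree_pt L s x"
    if "A \<in> topspace (mt_top K F L0)" "tree_shift 0 L A = \<Gamma>" "snd \<Gamma> = s" for A \<Gamma> s
  proof -
    obtain t x where "A = tree_pt L0 t x" "x \<in> sublevel K F t"
      using \<open>A \<in> _\<close> unfolding topspace_mt_top[OF g(1) L0] by blast
    moreover have "t = s" using calculation that(2,3) by (auto simp: ts snd_tree_pt)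
    ultimately show ?thesis using that(2) by (auto simp: ts)
  qed
  show ?thesis
    unfolding splinters_def top Let_def
  proof (intro exI[of _ "tree_shift 0 L"] conjI ballI allI impI; (elim conjE)?)
    show "continuous_map (mt_top K F L0) (mt_top K F L) (tree_shift 0 L)"
      by (rule continuous_map_tree_shift[OF g L(3,4) add_subgroup_0[OF subgroup]])
    show "tree_shift 0 L ` topspace (mt_top K F L0) = topspace (mt_top K F L)"
    proof -
      have img: "topspace (mt_top K F L') = (\<lambda>(s, x). tree_pt L' s x) ` {(s, x). x \<in> sublevel K F s}"
        if "add_subgroup L'" "L' \<subseteq> \<Lambda>" for L'
        unfolding topspace_mt_top[OF that] by force
      show ?thesis
        unfolding img[OF g(1) L0] img[OF g(2) L(4)] by (simp add: image_image case_prod_unfold ts)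
    qed
    show "snd (tree_shift 0 L A) = snd A" for A
      by (simp add: tree_shift_def split: prod.splits)
  next
    fix \<Gamma> A B
    assume A: "A \<in> topspace (mt_top K F L0)" "tree_shift 0 L A = \<Gamma>"
      and B: "B \<in> topspace (mt_top K F L0)" "tree_shift 0 L B = \<Gamma>"
    obtain x where x: "x \<in> sublevel K F (snd \<Gamma>)" "A = tree_pt L0 (snd \<Gamma>) x" "\<Gamma> = tree_pt L (snd \<Gamma>) x"
      using fib[OF A refl] by blast
    obtain y where y: "y \<in> sublevel K F (snd \<Gamma>)" "B = tree_pt L0 (snd \<Gamma>) y" "\<Gamma> = tree_pt L (snd \<Gamma>) y"
      using fib[OF B refl] by blast
    have B': "B \<in> {z \<in> topspace (mt_top K F L0). tree_shift 0 L z = tree_pt L (snd \<Gamma>) x}"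
      using B x(3) by auto
    \<comment> \<open>\<open>A\<close> and \<open>B\<close> lie in one fibre, hence differ by a
      translation from \<open>L\<close>, which carries one subtree to the other.\<close>
    then obtain v where "v \<in> L" "B = tree_pt L0 (snd \<Gamma>) (x + v)"
      unfolding tree_fibre[OF g L(3,4) x(1)] by blast
    then show "dI (subtree ?N A) (subtree ?N B) = 0"
      using dI_subtree_translate[OF g(1) L0, of v "snd \<Gamma>" x] x(2) L(4) by auto
    show "tree_shift 0 L ` topspace (ptop (subtree ?N A)) = topspace (ptop (subtree ?M \<Gamma>))"
      using tree_shift_subtree_onto[OF g L(3,4) x(1)] x(2,3) by metis
    show "tree_shift 0 L ` topspace (ptop (subtree ?N B)) = topspace (ptop (subtree ?M \<Gamma>))"
      using tree_shift_subtree_onto[OF g L(3,4) y(1)] y(2,3) by metis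
    have freq_eq: "pfreq ?N (tree_pt L0 s z) = (fst (pfreq ?M (tree_pt L s z)) /
        real (card {w \<in> topspace (mt_top K F L0). tree_shift 0 L w = tree_pt L s z}),
        snd (pfreq ?M (tree_pt L s z)))" if "z \<in> sublevel K F s" for s z
      unfolding freq card_tree_fibre[OF g L(3,4) that]
      by (rule shadow_monomial_sublattice[OF L that])
    show "pfreq ?N A = (fst (pfreq ?M \<Gamma>) /
        real (card {w \<in> topspace (mt_top K F L0). tree_shift 0 L w = \<Gamma>}), snd (pfreq ?M \<Gamma>))"
      using freq_eq[OF x(1)] x(2,3) by metis
    show "pfreq ?N B = (fst (pfreq ?M \<Gamma>) /
        real (card {w \<in> topspace (mt_top K F L0). tree_shift 0 L w = \<Gamma>}), snd (pfreq ?M \<Gamma>))"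
      using freq_eq[OF y(1)] y(2,3) by metis
  qed
qed

end

section \<open>The common sublattice and the vanishing of the pseudo-distance\<close>

text \<open>By \<open>index_mult\<close> with \<open>H = L\<close>, the finite index of
  \<open>L'\<close> in \<open>\<Lambda>\<close> makes the index of \<open>L \<inter> L'\<close> in
  \<open>L\<close> finite, which preserves the rank.\<close>

lemma is_lattice_Int:
  fixes \<Lambda> :: "'a::euclidean_space set"
  assumes "is_lattice \<Lambda> p" "is_lattice L p" "L \<subseteq> \<Lambda>" "is_lattice L' p" "L' \<subseteq> \<Lambda>"
  shows "is_lattice (L \<inter> L') p"
proof -
  have g: "add_subgroup \<Lambda>" "add_subgroup L" "add_subgroup L'"
    using assms is_lattice_add_subgroup by auto
  have sub: "add_subgroup (L \<inter> L')" "L \<inter> L' \<subseteq> L" using g add_subgroup_Int by auto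
  have "finite (tproj L' ` \<Lambda>)"
    using sublattice_index(1)[OF assms(1) g(3) assms(5)] lattice_dim_eq(2)[OF assms(4)] by blast
  then have "finite (tproj (L \<inter> L') ` L)"
    using index_mult(2)[OF g(1) g(3) assms(5) g(2) assms(3)] by blast
  then have "dim (L \<inter> L') = p"
    using finite_index_dim[OF g(2) sub] lattice_dim_eq(2)[OF assms(2)] by simp
  then show ?thesis using subgroup_is_lattice[OF assms(2) sub] by simp
qed

lemma periodic_subset:
  assumes "L \<subseteq> \<Lambda>"
  shows "periodic_complex K \<Lambda> \<Longrightarrow> periodic_complex K L"
    and "periodic_filter K F \<Lambda> \<Longrightarrow> periodic_filter K F L"
  using assms unfolding periodic_complex_def periodic_filter_def by blast+

lemma pmt_equiv_sublattices:
  fixes K :: "'a::euclidean_space set set"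
  assumes "is_lattice \<Lambda> DIM('a)" "cell_complex K" "periodic_complex K \<Lambda>"
    "filter_mono K F" "periodic_filter K F \<Lambda>"
    and L: "is_lattice L DIM('a)" "L \<subseteq> \<Lambda>" "is_lattice L' DIM('a)" "L' \<subseteq> \<Lambda>"
  shows "pmt_equiv (merge_tree K F L) (merge_tree K F L')"
proof -
  interpret periodic_filtration K F \<Lambda>
    using assms is_lattice_add_subgroup by unfold_locales auto
  have lat: "is_lattice (L \<inter> L') DIM('a)" by (rule is_lattice_Int[OF assms(1) L])
  have "is_pmt (merge_tree K F (L \<inter> L'))"
    unfolding is_pmt_def
    by (intro exI[of _ K] exI[of _ F] exI[of _ "L \<inter> L'"] conjI refl lat
        periodic_subset[of "L \<inter> L'" \<Lambda>]) (use assms in auto)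
  moreover have "splinters (merge_tree K F (L \<inter> L')) (merge_tree K F L)"
    "splinters (merge_tree K F (L \<inter> L')) (merge_tree K F L')"
    using splinters_sublattice lat L by auto
  ultimately show ?thesis unfolding pmt_equiv_def by blast
qed

lemma J_dist_nonneg: "0 \<le> J_dist M M'"
  unfolding J_dist_def by (rule Inf_greatest) (auto intro!: sum_nonneg dI_nonneg)

lemma J_dist_eq_0I:
  assumes "is_pmt M" "pmt_equiv M M" "pmt_equiv M M'"
  shows "J_dist M M' = 0"
proof (rule antisym[OF _ J_dist_nonneg])
  \<comment> \<open>The chain of length one from \<open>M\<close> to itself costs nothing; its right
    end is already equivalent to \<open>M'\<close>.\<close>
  have "(\<Sum>i<(1::nat). dI M M) = 0" by (simp add: dI_refl)
  then show "J_dist M M' \<le> 0"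
    unfolding J_dist_def using assms
    by (intro Inf_lower CollectI exI[of _ "1::nat"] exI[of _ "\<lambda>_. M"]) auto
qed

theorem mainTheorem2:
  fixes K :: "'a::euclidean_space set set"
    and F :: "'a set \<Rightarrow> real"
    and \<Lambda> \<Lambda>' \<Lambda>'' :: "'a set"
  assumes "is_lattice \<Lambda> DIM('a)"
    and "cell_complex K" and "periodic_complex K \<Lambda>"
    and "filter_mono K F" and "periodic_filter K F \<Lambda>"
    and "is_lattice \<Lambda>' DIM('a)" and "\<Lambda>' \<subseteq> \<Lambda>"
    and "is_lattice \<Lambda>'' DIM('a)" and "\<Lambda>'' \<subseteq> \<Lambda>"
  shows "pmt_equiv (merge_tree K F \<Lambda>') (merge_tree K F \<Lambda>'')
    \<and> J_dist (merge_tree K F \<Lambda>') (merge_tree K F \<Lambda>'') = 0"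
proof -
  have "is_pmt (merge_tree K F \<Lambda>')"
    unfolding is_pmt_def using assms periodic_subset[OF assms(7)] by blast
  \<comment> \<open>Reflexivity, wanted for the left end of the chain, is the case of two equal
    sublattices.\<close>
  moreover have "pmt_equiv (merge_tree K F \<Lambda>') (merge_tree K F \<Lambda>')"
    "pmt_equiv (merge_tree K F \<Lambda>') (merge_tree K F \<Lambda>'')"
    using pmt_equiv_sublattices[OF assms(1-5)] assms(6-9) by blast+
  ultimately show ?thesis using J_dist_eq_0I by blast
qed

end
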